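(* Let $F$, $f$, $(\xi_k)_{k\in\mathbb N}$, $G$, $H$, $(\alpha_k)_{k\in\mathbb N}$ and $(w_k)_{k\in\mathbb N}$ be as in the context, and suppose that (A1), (A2), (A3) hold. Let $i\in\{1,2\}$. If $i=1$, suppose that there is $w_*\in\arg\min_{w\in\mathbb R^d}F(w)$ satisfying both (A4) and (A6); if $i=2$, suppose that there is $w_*\in\arg\min_{w\in\mathbb R^d}F(w)$ satisfying both (A5) and (A6). Suppose that the step sizes are $\alpha_k=\frac{\beta}{k+\gamma}$ for all $k\in\mathbb N$, with $\beta,\gamma\in\mathbb R^+$. Then for every $K\in\mathbb N$ $$\min_{1\le k\le K}\mathbb E\big[\|\nabla F(w_k)\|^2\big]\le\frac{F(w_1)-F(w_* )}{\beta\ln(K+\gamma+1)}+B_i\,\frac{\beta(2+\gamma)}{\ln(K+\gamma+1)},$$ where $$B_1=2c_hL^3M+2c_hLM^{1/3}\sigma^2+c_g^2L^3M^{2/3}+c_g^2L\sigma^2,\qquad B_2=c_hL^3M+\frac{c_g^2L^3}{2}M^{2/3}.$$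
   Context: Notation: $\|\cdot\|$ is the Euclidean norm on $\mathbb R^d$, $d\in\mathbb N$; $\mathbb N=\{1,2,\dots\}$; $\mathbb R^+$ denotes the positive reals and $\mathbb R^+_0$ the non-negative reals. $(\Omega,\mathcal F,\mathbb P)$ is a complete probability space; $(\xi_k)_{k\in\mathbb N}$ is a sequence of independent, identically distributed random variables on $\Omega$, and $\xi$ denotes a random variable with their common distribution. The objective function is $F:\mathbb R^d\to\mathbb R$, $F(w)=\mathbb E[f(w,\xi)]$. Method: given functions $G,H:\mathbb R^d\times\mathbb R^+\to\mathbb R^d$ with $G(x,\alpha)=x-\alpha H(x,\alpha)$, step sizes $\alpha_k\in\mathbb R^+$ and a (deterministic) initial value $w_1\in\mathbb R^d$, the sequence $(w_k)_{k\in\mathbb N}$ is generated by $$w_{k+1}=w_k-\alpha_kG(\nabla f(w_k,\xi_k),\alpha_k)=w_k-\alpha_k\nabla f(w_k,\xi_k)+\alpha_k^2H(\nabla f(w_k,\xi_k),\alpha_k).$$ Assumptions: (A1) There are constants $c_g\in\mathbb R^+$ and $c_h\in\mathbb R^+_0$ such that $\|G(x,\alpha)\|\le c_g\|x\|$ and $\|H(x,\alpha)\|\le c_h\|x\|^2$ for all $x\in\mathbb R^d$, $\alpha\in\mathbb R^+$. (A2) (Unbiased gradients) The stochastic gradient $\nabla f(\cdot,\xi)$ satisfies $\mathbb E[\nabla f(v,\xi)]=\nabla F(v)$ for all $v\in\mathbb R^d$. (A3) (Lipschitz gradients) $F$ is continuously differentiable and $\|\nabla F(v)-\nabla F(w)\|\le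 L\|v-w\|$ for all $v,w\in\mathbb R^d$, with $L\in\mathbb R^+$. Moreover there is a $\sigma(\xi)$-measurable, square-integrable random variable $L_\xi$ with values in $\mathbb R^+$ such that almost surely $\|\nabla f(v,\xi)-\nabla f(w,\xi)\|\le L_\xi\|v-w\|$ for all $v,w\in\mathbb R^d$, and $\mathbb E[L_\xi^2]\le L^2$. (A4) (Bounded variance, for $w_*\in\arg\min F$) $\mathbb E[\|\nabla f(w_*,\xi)\|^2]\le\sigma^2$. (A5) (Interpolation, for $w_*\in\arg\min F$) almost surely $w_*\in\arg\min_{w\in\mathbb R^d}f(w,\xi)$; in particular $\nabla f(w_*,\xi)=0$ almost surely. (A6) (Moment bound, for $w_*$) there is $M\in\mathbb R^+$ with $\mathbb E[\|w_k-w_*\|^3]\le M$ for every $k\in\mathbb N$. *)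

theory Defs
  imports "HOL-Probability.Probability"
begin

text \<open>\<open>THE\<close> pins down the gradient only at points where \<open>f\<close> is differentiable; elsewhere the value is unspecified.\<close>

definition gradient :: "('a::euclidean_space \<Rightarrow> real) \<Rightarrow> 'a \<Rightarrow> 'a" where
  "gradient f x = (THE D. GDERIV f x :> D)"

lemma gradient_eqI:
  fixes f :: "'a::euclidean_space \<Rightarrow> real"
  assumes "GDERIV f x :> D"
  shows "gradient f x = D"
  unfolding gradient_def
proof (rule the_equality[where P = "\<lambda>D. GDERIV f x :> D", OF assms])
  fix E assume "GDERIV f x :> E"
  then have "(\<lambda>h. inner h E) = (\<lambda>h. inner h D)"
    using assms unfolding gderiv_def by (rule has_derivative_unique)
  then show "E = D"
    by (metis inner_commute vector_eq_rdot)
qed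

lemma GDERIV_gradient:
  fixes f :: "'a::euclidean_space \<Rightarrow> real"
  assumes "f differentiable (at x)"
  shows "GDERIV f x :> gradient f x"
proof -
  obtain f' where f': "(f has_derivative f') (at x)"
    using assms by (auto simp: differentiable_def)
  then have lin: "linear f'"
    by (simp add: has_derivative_linear)
  define D where "D = (\<Sum>b\<in>Basis. f' b *\<^sub>R b)"
  have "f' h = inner h D" for h
  proof -
    have "f' h = f' (\<Sum>b\<in>Basis. inner h b *\<^sub>R b)"
      by (simp add: euclidean_representation)
    also have "\<dots> = (\<Sum>b\<in>Basis. inner h b * f' b)"
      using lin by (simp add: linear_sum linear_scale)
    also have "\<dots> = inner h D"
      by (simp add: D_def inner_sum_right mult.commute)
    finally show ?thesis .
  qed
  then have "f' = (\<lambda>h. inner h D)" by (rule ext)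
  with f' have "GDERIV f x :> D" by (simp add: gderiv_def)
  then show ?thesis by (simp add: gradient_eqI)
qed

end

theory Submission
  imports Defs
begin

text \<open>
  The quadratic upper bound for \<open>F\<close> and the independence of \<open>w\<^sub>k\<close> and \<open>\<xi>\<^sub>k\<close> give
  \<open>E F(w\<^sub>k\<^sub>+\<^sub>1) \<le> E F(w\<^sub>k) - \<alpha>\<^sub>k g\<^sub>k + \<alpha>\<^sub>k\<^sup>2 B\<close> with \<open>g\<^sub>k = E \<parallel>\<nabla>F(w\<^sub>k)\<parallel>\<^sup>2\<close>.
  Telescoping alone does not give the stated rate, because \<open>\<Sum>\<^sub>k\<^sub>\<le>\<^sub>K 1 / (k + \<gamma>)\<close> need not reach
  \<open>ln (K + \<gamma> + 1)\<close>; it is only at least \<open>ln (K + \<gamma> + 1) - ln (1 + \<gamma>)\<close>. The deficit is recovered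
  from two further bounds on the minimum \<open>m\<close> of the \<open>g\<^sub>k\<close>. Stopping at \<open>w\<^sub>K\<close>, the remaining gap
  \<open>E F(w\<^sub>K) - min F\<close> is at least \<open>m / (2 L)\<close>; and \<open>m \<le> g\<^sub>1 \<le> L\<^sup>2 M\<^bsup>2/3\<^esup>\<close> together with \<open>c\<^sub>g \<ge> 1\<close>
  (let \<open>\<alpha> \<rightarrow> 0\<close> in the growth bounds) yields \<open>m L / 2 \<le> B\<close>. The right-hand side leaves
  \<open>\<beta>\<^sup>2 B Q\<close> of slack with \<open>Q = 2 + \<gamma> - \<Sum>\<^sub>k\<^sub><\<^sub>K 1 / (k + \<gamma>)\<^sup>2\<close>, and by AM-GM the two bounds contribute
  \<open>m \<beta> sqrt Q\<close>, which covers the deficit.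
\<close>

subsection \<open>Functions with Lipschitz gradient\<close>

lemma gradient_has_real_derivative_line:
  fixes f :: "'a::euclidean_space \<Rightarrow> real"
  assumes "\<And>v. f differentiable (at v)"
  shows "((\<lambda>t. f (v + t *\<^sub>R d)) has_real_derivative inner d (gradient f (v + t *\<^sub>R d))) (at t)"
proof -
  have "(f has_derivative (\<lambda>h. inner h (gradient f (v + t *\<^sub>R d)))) (at (v + t *\<^sub>R d))"
    using GDERIV_gradient[OF assms] by (simp add: gderiv_def)
  moreover have "((\<lambda>t. v + t *\<^sub>R d) has_derivative (\<lambda>h. h *\<^sub>R d)) (at t)"
    by (auto intro!: derivative_eq_intros)
  ultimately have "((\<lambda>t. f (v + t *\<^sub>R d)) has_derivative
      (\<lambda>h. inner (h *\<^sub>R d) (gradient f (v + t *\<^sub>R d)))) (at t)"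
    by (rule has_derivative_compose[rotated])
  then show ?thesis
    by (simp add: has_field_derivative_def mult_commute_abs)
qed

text \<open>On the segment from \<open>v\<close> to \<open>u\<close>, subtracting the linear and
  quadratic terms from \<open>f\<close> leaves \<open>\<psi>\<close>, whose derivative is
  nonpositive by Cauchy-Schwarz and the Lipschitz bound. Monotonicity thus replaces integration of
  the gradient.\<close>

lemma Lipschitz_gradient_quadratic_bound:
  fixes f :: "'a::euclidean_space \<Rightarrow> real"
  assumes diff: "\<And>v. f differentiable (at v)"
    and lip: "\<And>u v. norm (gradient f u - gradient f v) \<le> L * norm (u - v)"
  shows "f u \<le> f v + inner (u - v) (gradient f v) + L / 2 * (norm (u - v))\<^sup>2"
proof -
  define d where "d = u - v"
  define \<psi> where "\<psi> t = f (v + t *\<^sub>R d) - t * inner d (gradient f v) - L * t\<^sup>2 / 2 * (norm d)\<^sup>2" for t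
  have "\<psi> 1 \<le> \<psi> 0"
  proof (rule DERIV_nonpos_imp_nonincreasing[of 0 1 \<psi>])
    fix t :: real assume t: "0 \<le> t" "t \<le> 1"
    let ?y = "inner d (gradient f (v + t *\<^sub>R d)) - inner d (gradient f v) - L * t * (norm d)\<^sup>2"
    have "(\<psi> has_real_derivative ?y) (at t)"
      unfolding \<psi>_def
      by (auto intro!: derivative_eq_intros gradient_has_real_derivative_line[OF diff])
    moreover have "?y \<le> 0"
    proof -
      have "inner d (gradient f (v + t *\<^sub>R d)) - inner d (gradient f v)
          = inner d (gradient f (v + t *\<^sub>R d) - gradient f v)"
        by (simp add: inner_diff_right)
      also have "\<dots> \<le> norm d * norm (gradient f (v + t *\<^sub>R d) - gradient f v)"
        by (rule norm_cauchy_schwarz)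
      also have "\<dots> \<le> norm d * (L * norm (v + t *\<^sub>R d - v))"
        by (intro mult_left_mono lip) simp
      also have "\<dots> = L * t * (norm d)\<^sup>2"
        using t by (simp add: power2_eq_square)
      finally show ?thesis by simp
    qed
    ultimately show "\<exists>y. (\<psi> has_real_derivative y) (at t) \<and> y \<le> 0" by blast
  qed simp
  then show ?thesis by (simp add: \<psi>_def d_def)
qed

text \<open>A gradient step of size \<open>1 / L\<close> lowers the quadratic bound by
  \<open>(norm (gradient f v))\<^sup>2 / (2 * L)\<close>, yet its end point cannot lie below the
  minimum \<open>f z\<close>.\<close>

lemma norm_gradient_sq_le_gap:
  fixes f :: "'a::euclidean_space \<Rightarrow> real"
  assumes diff: "\<And>v. f differentiable (at v)"
    and lip: "\<And>u v. norm (gradient f u - gradient f v) \<le> L * norm (u - v)"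
    and L: "L > 0" and min: "is_arg_min f (\<lambda>_. True) z"
  shows "(norm (gradient f v))\<^sup>2 \<le> 2 * L * (f v - f z)"
proof -
  let ?g = "gradient f v"
  let ?u = "v - (1 / L) *\<^sub>R ?g"
  have "f z \<le> f ?u"
    using min by (auto simp: is_arg_min_def not_less)
  also have "\<dots> \<le> f v + inner (?u - v) ?g + L / 2 * (norm (?u - v))\<^sup>2"
    by (rule Lipschitz_gradient_quadratic_bound[OF diff lip])
  also have "\<dots> = f v - (norm ?g)\<^sup>2 / (2 * L)"
    using L by (simp add: dot_square_norm field_simps power2_eq_square)
  finally show ?thesis using L by (simp add: field_simps)
qed

lemma gradient_eq_0_at_arg_min:
  fixes f :: "'a::euclidean_space \<Rightarrow> real"
  assumes "\<And>v. f differentiable (at v)"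
    and "\<And>u v. norm (gradient f u - gradient f v) \<le> L * norm (u - v)"
    and "L > 0" and "is_arg_min f (\<lambda>_. True) z"
  shows "gradient f z = 0"
  using norm_gradient_sq_le_gap[OF assms, of z] by simp

subsection \<open>Harmonic sums\<close>

text \<open>This is \<open>ln y \<le> y - 1\<close> at \<open>y = sqrt x / 2\<close>, with equality
  at \<open>x = 4\<close>. Since \<open>ln 2 < 1\<close>, the constant is negative, which leaves
  room for the small terms in the estimates below.\<close>

lemma ln_le_sqrt_minus:
  fixes x :: real
  assumes "x > 0"
  shows "ln x \<le> sqrt x - 2 + 2 * ln 2"
proof -
  have "ln x = 2 * ln (sqrt x / 2) + 2 * ln 2"
    using assms by (simp add: ln_div ln_sqrt)
  moreover have "ln (sqrt x / 2) \<le> sqrt x / 2 - 1"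
    using assms by (intro ln_le_minus_one) simp
  ultimately show ?thesis by simp
qed


lemma sum_inverse_ge_ln:
  fixes \<gamma> :: real
  assumes "\<gamma> > 0" and "1 \<le> K"
  shows "ln (real K + \<gamma>) - ln (1 + \<gamma>) \<le> (\<Sum>k=1..<K. 1 / (real k + \<gamma>))"
  using assms(2)
proof (induction K rule: nat_induct_at_least)
  case base
  then show ?case by simp
next
  case (Suc K)
  have "ln (1 + 1 / (real K + \<gamma>)) \<le> 1 / (real K + \<gamma>)"
    using assms(1) by (intro ln_add_one_self_le_self) simp
  moreover have "1 + 1 / (real K + \<gamma>) = (real (Suc K) + \<gamma>) / (real K + \<gamma>)"
    using assms(1) by (simp add: field_simps)
  ultimately have "ln (real (Suc K) + \<gamma>) \<le> ln (real K + \<gamma>) + 1 / (real K + \<gamma>)"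
    using assms(1) by (simp add: ln_div)
  with Suc show ?case by simp
qed

text \<open>With \<open>x = k + \<gamma>\<close>, each later term is below
  \<open>1 / (x\<^sup>2 - 1 / 4)\<close>, which telescopes between the midpoints
  \<open>x - 1 / 2\<close> and \<open>x + 1 / 2\<close>. The term \<open>k = 1\<close> stays exact:
  for \<open>\<gamma>\<close> near 0, telescoping it too would only give a bound near 2, the whole
  of \<open>2 + \<gamma>\<close>.\<close>

lemma sum_inverse_squares_le:
  fixes \<gamma> :: real
  assumes "\<gamma> > 0" and "2 \<le> K"
  shows "(\<Sum>k=1..<K. 1 / (real k + \<gamma>)\<^sup>2)
    \<le> 1 / (1 + \<gamma>)\<^sup>2 + 1 / (3 / 2 + \<gamma>) - 1 / (real K - 1 / 2 + \<gamma>)"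
  using assms(2)
proof (induction K rule: nat_induct_at_least)
  case base
  then show ?case by (simp add: numeral_2_eq_2)
next
  case (Suc K)
  let ?x = "real K + \<gamma>"
  have x: "?x > 1" using Suc.hyps assms(1) by simp
  have x2: "?x\<^sup>2 > 1" using x by simp
  have "1 / ?x\<^sup>2 \<le> 1 / (?x\<^sup>2 - 1 / 4)"
    using x2 by (intro divide_left_mono mult_pos_pos) auto
  also have "\<dots> = 1 / ((?x - 1 / 2) * (?x + 1 / 2))"
    by (simp add: power2_eq_square algebra_simps)
  also have "\<dots> = 1 / (?x - 1 / 2) - 1 / (?x + 1 / 2)"
    using x by (subst diff_frac_eq) auto
  finally have "1 / ?x\<^sup>2 \<le> 1 / (?x - 1 / 2) - 1 / (?x + 1 / 2)" .
  moreover have "1 / (real K - 1 / 2 + \<gamma>) = 1 / (?x - 1 / 2)"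
      "1 / (real (Suc K) - 1 / 2 + \<gamma>) = 1 / (?x + 1 / 2)"
    by (simp_all add: algebra_simps)
  moreover have "(\<Sum>k=1..<Suc K. 1 / (real k + \<gamma>)\<^sup>2) = (\<Sum>k=1..<K. 1 / (real k + \<gamma>)\<^sup>2) + 1 / ?x\<^sup>2"
    using Suc.hyps by simp
  ultimately show ?case using Suc.IH by linarith
qed

text \<open>The left side is what the harmonic sum may miss: \<open>ln (1 + \<gamma>)\<close> at its
  start and \<open>1 / (2 + \<gamma>)\<close> for the last increment of the logarithm. The radicand
  is a lower bound of the later \<open>Q\<close> that does not depend on \<open>K\<close>.\<close>

lemma sqrt_sum_bound:
  fixes \<gamma> :: real
  assumes g: "\<gamma> > 0"
  shows "ln (1 + \<gamma>) + 1 / (2 + \<gamma>) \<le> sqrt (2 + \<gamma> - (1 / (1 + \<gamma>)\<^sup>2 + 1 / (3 / 2 + \<gamma>)))"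
proof (cases "\<gamma> \<le> 1")
  case True
  \<comment> \<open>For \<open>\<gamma> \<le> 1\<close> the logarithm is replaced by its tangent at
    \<open>\<gamma> = 0\<close>, and each convex term, including the final square, by its chord over
    the interval from 0 to 1. A comparison of linear functions remains.\<close>
  have "ln (1 + \<gamma>) \<le> \<gamma>" using g by (intro ln_add_one_self_le_self) simp
  moreover have "1 / (2 + \<gamma>) \<le> 1 / 2 - \<gamma> / 6"
  proof -
    have "1 \<le> (1 / 2 - \<gamma> / 6) * (2 + \<gamma>)"
      using g True mult_nonneg_nonneg[of \<gamma> "1 - \<gamma>"] by (simp add: algebra_simps)
    then show ?thesis using g by (simp add: divide_le_eq)
  qed
  ultimately have "ln (1 + \<gamma>) + 1 / (2 + \<gamma>) \<le> 1 / 2 + 5 * \<gamma> / 6" by simp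
  moreover have "1 / 2 + 5 * \<gamma> / 6 \<le> sqrt (2 + \<gamma> - (1 / (1 + \<gamma>)\<^sup>2 + 1 / (3 / 2 + \<gamma>)))"
  proof (rule real_le_rsqrt)
    have "1 / (1 + \<gamma>)\<^sup>2 \<le> 1 - 3 * \<gamma> / 4"
    proof -
      have "1 \<le> (1 - 3 * \<gamma> / 4) * (1 + \<gamma>)\<^sup>2"
      proof -
        have "(1 - 3 * \<gamma> / 4) * (1 + \<gamma>)\<^sup>2 - 1 = \<gamma> * (1 - \<gamma>) * (5 + 3 * \<gamma>) / 4"
          by (simp add: power2_eq_square field_simps)
        moreover have "\<dots> \<ge> 0" using g True by simp
        ultimately show ?thesis by linarith
      qed
      then show ?thesis using g by (simp add: divide_le_eq)
    qed
    moreover have "1 / (3 / 2 + \<gamma>) \<le> 2 / 3 - 4 * \<gamma> / 15"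
    proof -
      have "(2 / 3 - 4 * \<gamma> / 15) * (3 / 2 + \<gamma>) - 1 = 4 / 15 * (\<gamma> * (1 - \<gamma>))"
        by (simp add: field_simps)
      moreover have "\<dots> \<ge> 0" using g True by simp
      ultimately have "1 \<le> (2 / 3 - 4 * \<gamma> / 15) * (3 / 2 + \<gamma>)" by linarith
      then show ?thesis using g by (simp add: divide_le_eq)
    qed
    moreover have "(1 / 2 + 5 * \<gamma> / 6)\<^sup>2 \<le> 1 / 4 + 55 / 36 * \<gamma>"
    proof -
      have "\<gamma> * \<gamma> \<le> \<gamma>" using g True by (simp add: mult_left_le)
      then show ?thesis by (simp add: power2_eq_square algebra_simps)
    qed
    ultimately show "(1 / 2 + 5 * \<gamma> / 6)\<^sup>2 \<le> 2 + \<gamma> - (1 / (1 + \<gamma>)\<^sup>2 + 1 / (3 / 2 + \<gamma>))"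
      using g by linarith
  qed
  ultimately show ?thesis by linarith
next
  case False
  \<comment> \<open>For \<open>\<gamma> > 1\<close> the subtracted fractions total at most
    \<open>1 / 4 + 2 / 5 < 1\<close>, so the radicand exceeds \<open>1 + \<gamma>\<close>; the
    constants fit because \<open>25 / 18 + 1 / 3 < 2\<close>.\<close>
  have "ln (1 + \<gamma>) \<le> sqrt (1 + \<gamma>) - 2 + 2 * ln 2"
    using g by (intro ln_le_sqrt_minus) simp
  moreover have "ln (2::real) \<le> 25 / 36" using ln2_le_25_over_36 by simp
  moreover have "1 / (2 + \<gamma>) \<le> 1 / 3" using False by (simp add: field_simps)
  moreover have "sqrt (1 + \<gamma>) \<le> sqrt (2 + \<gamma> - (1 / (1 + \<gamma>)\<^sup>2 + 1 / (3 / 2 + \<gamma>)))"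
  proof -
    have "(1 + \<gamma>)\<^sup>2 \<ge> 2\<^sup>2" using False by (intro power_mono) auto
    then have "1 / (1 + \<gamma>)\<^sup>2 \<le> 1 / 4" using False by (simp add: divide_simps)
    moreover have "1 / (3 / 2 + \<gamma>) \<le> 2 / 5" using False by (simp add: divide_simps)
    ultimately show ?thesis by simp
  qed
  ultimately show ?thesis by linarith
qed

text \<open>\<open>Q\<close> is what the sum of squares leaves of the factor
  \<open>2 + \<gamma>\<close>; its root pays for the difference between the logarithm and the
  harmonic sum.\<close>

lemma ln_le_sum_plus_sqrt:
  fixes \<gamma> :: real
  assumes g: "\<gamma> > 0" and K: "1 \<le> K"
  defines "Q \<equiv> 2 + \<gamma> - (\<Sum>k=1..<K. 1 / (real k + \<gamma>)\<^sup>2)"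
  shows "0 < Q" and "ln (real K + \<gamma> + 1) \<le> (\<Sum>k=1..<K. 1 / (real k + \<gamma>)) + sqrt Q"
proof -
  have "ln (real K + \<gamma> + 1) \<le> (\<Sum>k=1..<K. 1 / (real k + \<gamma>)) + sqrt Q \<and> 0 < Q"
  proof (cases "K = 1")
    \<comment> \<open>Both sums are empty here, so \<open>Q = 2 + \<gamma>\<close>.\<close>
    case True
    have "ln (2 + \<gamma>) \<le> sqrt (2 + \<gamma>) - 2 + 2 * ln 2"
      using g by (intro ln_le_sqrt_minus) simp
    moreover have "ln (2::real) \<le> 25 / 36" using ln2_le_25_over_36 by simp
    ultimately show ?thesis using True g by (simp add: Q_def add.commute add.left_commute)
  next
    case False
    then have K2: "2 \<le> K" using K by simp
    let ?q = "2 + \<gamma> - (1 / (1 + \<gamma>)\<^sup>2 + 1 / (3 / 2 + \<gamma>))"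
    have "1 / (real K - 1 / 2 + \<gamma>) \<ge> 0" using K2 g by simp
    then have qQ: "?q \<le> Q" using sum_inverse_squares_le[OF g K2] unfolding Q_def by linarith
    have ln: "ln (1 + \<gamma>) + 1 / (2 + \<gamma>) \<le> sqrt ?q" by (rule sqrt_sum_bound[OF g])
    moreover have "0 < ln (1 + \<gamma>) + 1 / (2 + \<gamma>)" using g by (simp add: add_pos_pos)
    ultimately have "0 < sqrt ?q" by linarith
    \<comment> \<open>\<open>sqrt\<close> is negative on negative reals, so a positive root forces a
      positive radicand; no separate estimate of \<open>?q\<close> is required.\<close>
    then have "0 < ?q" by (simp only: real_sqrt_gt_0_iff)
    moreover have "sqrt ?q \<le> sqrt Q" using qQ by (rule real_sqrt_le_mono)
    moreover have "ln (real (Suc K) + \<gamma>) \<le> ln (real K + \<gamma>) + 1 / (2 + \<gamma>)"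
    proof -
      have "ln (1 + 1 / (real K + \<gamma>)) \<le> 1 / (real K + \<gamma>)"
        using g by (intro ln_add_one_self_le_self) simp
      moreover have "1 + 1 / (real K + \<gamma>) = (real (Suc K) + \<gamma>) / (real K + \<gamma>)"
        using g K by (simp add: field_simps)
      moreover have "1 / (real K + \<gamma>) \<le> 1 / (2 + \<gamma>)" using g K2 by (simp add: frac_le)
      ultimately show ?thesis using g K by (simp add: ln_div)
    qed
    ultimately have "ln (real (Suc K) + \<gamma>) \<le> (\<Sum>k=1..<K. 1 / (real k + \<gamma>)) + sqrt Q" and "0 < Q"
      using sum_inverse_ge_ln[OF g K] ln qQ by linarith+
    then show ?thesis by (simp add: add_ac)
  qed
  then show "0 < Q" and "ln (real K + \<gamma> + 1) \<le> (\<Sum>k=1..<K. 1 / (real k + \<gamma>)) + sqrt Q"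
    by auto
qed

text \<open>The probability-free core: \<open>g k\<close> stands for the expected squared gradient
  norm at step \<open>k\<close> and \<open>\<Delta>\<close> for the initial gap. The sums stop
  before \<open>K\<close> because the last iterate enters through its own gap, the left side of
  \<open>descent\<close>.\<close>

lemma min_le_log_rate:
  fixes g :: "nat \<Rightarrow> real"
  assumes \<beta>: "\<beta> > 0" and \<gamma>: "\<gamma> > 0" and L: "L > 0" and K: "K \<ge> 1"
    and m: "0 \<le> m" "\<And>k. k \<in> {1..K} \<Longrightarrow> m \<le> g k"
    and descent: "m / (2 * L) \<le> \<Delta> - (\<Sum>k=1..<K. \<beta> / (real k + \<gamma>) * g k)
      + B * (\<Sum>k=1..<K. (\<beta> / (real k + \<gamma>))\<^sup>2)"
    and B: "m * L / 2 \<le> B"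
  shows "m \<le> \<Delta> / (\<beta> * ln (real K + \<gamma> + 1)) + B * (\<beta> * (2 + \<gamma>) / ln (real K + \<gamma> + 1))"
proof -
  define S1 where "S1 = (\<Sum>k=1..<K. 1 / (real k + \<gamma>))"
  define S2 where "S2 = (\<Sum>k=1..<K. 1 / (real k + \<gamma>)\<^sup>2)"
  define Q where "Q = 2 + \<gamma> - S2"
  let ?l = "ln (real K + \<gamma> + 1)"
  have Q: "0 < Q" "?l \<le> S1 + sqrt Q"
    using ln_le_sum_plus_sqrt[OF \<gamma> K] by (simp_all add: Q_def S1_def S2_def)
  have "m * \<beta> * S1 \<le> (\<Sum>k=1..<K. \<beta> / (real k + \<gamma>) * g k)"
    unfolding S1_def sum_distrib_left
  proof (rule sum_mono)
    fix k assume "k \<in> {1..<K}"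
    then have "m \<le> g k" using m(2) by simp
    then have "\<beta> / (real k + \<gamma>) * m \<le> \<beta> / (real k + \<gamma>) * g k"
      using \<beta> \<gamma> by (intro mult_left_mono) auto
    then show "m * \<beta> * (1 / (real k + \<gamma>)) \<le> \<beta> / (real k + \<gamma>) * g k" by (simp add: mult.commute)
  qed
  moreover have S2: "(\<Sum>k=1..<K. (\<beta> / (real k + \<gamma>))\<^sup>2) = \<beta>\<^sup>2 * S2"
    by (simp add: S2_def sum_distrib_left power_divide)
  ultimately have S1: "m * \<beta> * S1 \<le> \<Delta> + B * (\<beta>\<^sup>2 * S2) - m / (2 * L)"
    using descent unfolding S2 by linarith
  have "m * \<beta> * sqrt Q \<le> m / (2 * L) + B * (\<beta>\<^sup>2 * Q)"
  proof -
    txt \<open>AM-GM balances the terminal gap, worth at least \<open>m / (2 L)\<close>, against \<open>B \<ge> m L / 2\<close>.\<close>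
    have "2 * (\<beta> * sqrt Q * L) \<le> 1 + (\<beta> * sqrt Q * L)\<^sup>2"
      using sum_squares_bound[of 1 "\<beta> * sqrt Q * L"] by simp
    also have "\<dots> = 1 + L\<^sup>2 * (\<beta>\<^sup>2 * Q)" using Q by (simp add: power_mult_distrib)
    finally have "2 * (\<beta> * sqrt Q * L) / (2 * L) \<le> (1 + L\<^sup>2 * (\<beta>\<^sup>2 * Q)) / (2 * L)"
      using L by (intro divide_right_mono) auto
    then have "\<beta> * sqrt Q \<le> 1 / (2 * L) + L / 2 * (\<beta>\<^sup>2 * Q)"
      using L by (simp add: add_divide_distrib power2_eq_square)
    then have "m * (\<beta> * sqrt Q) \<le> m * (1 / (2 * L) + L / 2 * (\<beta>\<^sup>2 * Q))"
      using m by (intro mult_left_mono)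
    also have "\<dots> = m / (2 * L) + m * L / 2 * (\<beta>\<^sup>2 * Q)" by (simp add: algebra_simps)
    also have "\<dots> \<le> m / (2 * L) + B * (\<beta>\<^sup>2 * Q)"
      using B Q by (intro add_left_mono mult_right_mono) auto
    finally show ?thesis by (simp add: mult.assoc)
  qed
  moreover have "m * \<beta> * ?l \<le> m * \<beta> * (S1 + sqrt Q)"
    using Q m \<beta> by (intro mult_left_mono) auto
  \<comment> \<open>The terms \<open>m / (2 * L)\<close> cancel, and
    \<open>S2 + Q = 2 + \<gamma>\<close> by the choice of \<open>Q\<close>, which yields exactly the
    factor in the claim.\<close>
  ultimately have "m * \<beta> * ?l \<le> \<Delta> + B * (\<beta>\<^sup>2 * (S2 + Q))"
    using S1 by (simp add: algebra_simps)
  then have *: "m * \<beta> * ?l \<le> \<Delta> + B * (\<beta>\<^sup>2 * (2 + \<gamma>))" by (simp add: Q_def)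
  have l: "?l > 0" using \<gamma> K by (intro ln_gt_zero) simp
  have "m = m * \<beta> * ?l / (\<beta> * ?l)" using l \<beta> by simp
  also have "\<dots> \<le> (\<Delta> + B * (\<beta>\<^sup>2 * (2 + \<gamma>))) / (\<beta> * ?l)"
    using * l \<beta> by (intro divide_right_mono) auto
  also have "\<dots> = \<Delta> / (\<beta> * ?l) + B * (\<beta> * (2 + \<gamma>) / ?l)"
    using \<beta> by (simp add: add_divide_distrib power2_eq_square)
  finally show ?thesis .
qed

subsection \<open>Measurability and independence\<close>

text \<open>Approximate \<open>v\<close> by simple functions \<open>r n\<close>. For fixed
  \<open>n\<close> the composite is glued from finitely many measurable functions
  \<open>h v\<close>, selected by the value of \<open>r n\<close>; continuity in \<open>v\<close>
  makes these composites converge to \<open>h\<close>.\<close>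

lemma borel_measurable_Caratheodory:
  fixes h :: "'a::{second_countable_topology, metric_space} \<Rightarrow> 's \<Rightarrow> 'b::{second_countable_topology, metric_space}"
  assumes meas: "\<And>v. h v \<in> borel_measurable S"
    and cont: "\<And>s. s \<in> space S \<Longrightarrow> continuous_on UNIV (\<lambda>v. h v s)"
  shows "(\<lambda>(v, s). h v s) \<in> borel_measurable (borel \<Otimes>\<^sub>M S)"
proof -
  obtain r :: "nat \<Rightarrow> 'a \<Rightarrow> 'a"
    where r: "\<And>n. simple_function borel (r n)" "\<And>v. (\<lambda>n. r n v) \<longlonglongrightarrow> v"
  proof -
    have "(\<lambda>v::'a. v) \<in> borel_measurable borel" by simp
    from borel_measurable_implies_sequence_metric[OF this, of undefined]
    obtain r :: "nat \<Rightarrow> 'a \<Rightarrow> 'a" where "\<forall>n. simple_function borel (r n)"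
      and "\<forall>v\<in>space borel. (\<lambda>n. r n v) \<longlonglongrightarrow> v" by (elim exE conjE) rule
    then show ?thesis by (intro that[of r]) simp_all
  qed
  show ?thesis
  proof (rule borel_measurable_LIMSEQ_metric)
    fix n
    have fin: "finite (range (r n))" using r(1)[of n] by (simp add: simple_function_def)
    have "r n \<in> measurable borel (count_space (range (r n)))"
      unfolding measurable_count_space_eq2[OF fin] using r(1)[of n] by (simp add: simple_function_def)
    then have sel: "(\<lambda>x. r n (fst x)) \<in> measurable (borel \<Otimes>\<^sub>M S) (count_space (range (r n)))"
      by simp
    have "(\<lambda>x. h v (snd x)) \<in> borel_measurable (borel \<Otimes>\<^sub>M S)" for v
      using meas by simp
    from this sel show "(\<lambda>x. h (r n (fst x)) (snd x)) \<in> borel_measurable (borel \<Otimes>\<^sub>M S)"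
      using fin
      by (rule measurable_compose_countable'[where I = "range (r n)" and f = "\<lambda>v x. h v (snd x)", OF _ _ countable_finite])
  next
    fix x :: "'a \<times> 's" assume "x \<in> space (borel \<Otimes>\<^sub>M S)"
    then have "snd x \<in> space S" by (auto simp: space_pair_measure)
    from continuous_on_tendsto_compose[OF cont[OF this] r(2)[of "fst x"]]
    show "(\<lambda>n. h (r n (fst x)) (snd x)) \<longlonglongrightarrow> (case x of (v, s) \<Rightarrow> h v s)"
      by (simp add: case_prod_beta)
  qed
qed

text \<open>Each coordinate of the gradient is the limit of difference quotients with increments
  \<open>1 / (n + 1)\<close>. These are jointly measurable because \<open>f\<close> is measurable in
  \<open>s\<close> and, being differentiable, continuous in \<open>v\<close>.\<close>

lemma borel_measurable_gradient:
  fixes f :: "'a::euclidean_space \<Rightarrow> 's \<Rightarrow> real"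
  assumes meas: "\<And>v. f v \<in> borel_measurable S"
    and diff: "\<And>v s. s \<in> space S \<Longrightarrow> (\<lambda>u. f u s) differentiable (at v)"
  shows "(\<lambda>(v, s). gradient (\<lambda>u. f u s) v) \<in> borel_measurable (borel \<Otimes>\<^sub>M S)"
proof (rule borel_measurable_euclidean_space[THEN iffD2], rule ballI)
  fix b :: 'a assume "b \<in> Basis"
  have joint: "(\<lambda>(v, s). f v s) \<in> borel_measurable (borel \<Otimes>\<^sub>M S)"
  proof (rule borel_measurable_Caratheodory[OF meas])
    fix s assume "s \<in> space S"
    then have "(\<lambda>v. f v s) differentiable_on UNIV"
      using diff by (simp add: differentiable_on_def)
    then show "continuous_on UNIV (\<lambda>v. f v s)" by (rule differentiable_imp_continuous_on)
  qed
  show "(\<lambda>x. inner (case x of (v, s) \<Rightarrow> gradient (\<lambda>u. f u s) v) b) \<in> borel_measurable (borel \<Otimes>\<^sub>M S)"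
  proof (rule borel_measurable_LIMSEQ_real)
    fix n
    have [measurable]: "(\<lambda>x. f (fst x + c) (snd x)) \<in> borel_measurable (borel \<Otimes>\<^sub>M S)" for c
    proof -
      have "(\<lambda>x. (fst x + c, snd x)) \<in> measurable (borel \<Otimes>\<^sub>M S) (borel \<Otimes>\<^sub>M S)" by measurable
      from measurable_compose[OF this joint] show ?thesis by simp
    qed
    \<comment> \<open>The summand 0 gives both evaluations the shifted form covered by the preceding
      measurability fact.\<close>
    show "(\<lambda>x. (f (fst x + inverse (real (Suc n)) *\<^sub>R b) (snd x) - f (fst x + 0) (snd x))
        / inverse (real (Suc n))) \<in> borel_measurable (borel \<Otimes>\<^sub>M S)"
      by measurable
  next
    fix x :: "'a \<times> 's" assume "x \<in> space (borel \<Otimes>\<^sub>M S)"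
    then have s: "snd x \<in> space S" by (auto simp: space_pair_measure)
    have "((\<lambda>h. (f (fst x + h *\<^sub>R b) (snd x) - f (fst x) (snd x)) / h) \<longlongrightarrow>
        inner b (gradient (\<lambda>u. f u (snd x)) (fst x))) (at 0)"
      using gradient_has_real_derivative_line[of "\<lambda>u. f u (snd x)" "fst x" b 0, OF diff[OF s]]
      by (simp add: DERIV_def)
    then have "(\<lambda>n. (f (fst x + inverse (real (Suc n)) *\<^sub>R b) (snd x) - f (fst x) (snd x))
        / inverse (real (Suc n))) \<longlonglongrightarrow> inner b (gradient (\<lambda>u. f u (snd x)) (fst x))"
      by (rule filterlim_compose)
        (simp add: filterlim_at LIMSEQ_inverse_real_of_nat del: of_nat_Suc)
    then show "(\<lambda>n. (f (fst x + inverse (real (Suc n)) *\<^sub>R b) (snd x) - f (fst x + 0) (snd x))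
        / inverse (real (Suc n))) \<longlonglongrightarrow> inner (case x of (v, s) \<Rightarrow> gradient (\<lambda>u. f u s) v) b"
      by (simp add: case_prod_beta inner_commute)
  qed
qed

text \<open>The library's \<open>indep_var\<close> forces both random variables to have the same codomain type.\<close>

definition (in prob_space) indep_pair where
  "indep_pair N W S Y \<longleftrightarrow> W \<in> measurable M N \<and> Y \<in> measurable M S \<and>
    distr M N W \<Otimes>\<^sub>M distr M S Y = distr M (N \<Otimes>\<^sub>M S) (\<lambda>x. (W x, Y x))"

text \<open>The iterate \<open>w k\<close> is a measurable function \<open>\<phi>\<close> of the
  samples with indices from \<open>m\<close> to \<open>k - 1\<close> only, and this block is
  independent of \<open>X k\<close>.\<close>

lemma (in prob_space) indep_pair_iterates:
  assumes indep: "indep_vars (\<lambda>_. S) X {m..}"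
    and T: "\<And>k. k \<ge> m \<Longrightarrow> T k \<in> measurable (N \<Otimes>\<^sub>M S) N"
    and init: "\<And>\<omega>. \<omega> \<in> space M \<Longrightarrow> w m \<omega> = w0" and w0: "w0 \<in> space N"
    and step: "\<And>k \<omega>. k \<ge> m \<Longrightarrow> \<omega> \<in> space M \<Longrightarrow> w (Suc k) \<omega> = T k (w k \<omega>, X k \<omega>)"
    and k: "(m::nat) \<le> k"
  shows "indep_pair N (w k) S (X k)"
proof -
  have X: "X j \<in> measurable M S" if "j \<ge> m" for j
    using indep that by (auto simp: indep_vars_def)
  have "\<exists>\<phi>\<in>measurable (Pi\<^sub>M {m..<k} (\<lambda>_. S)) N. \<forall>\<omega>\<in>space M. w k \<omega> = \<phi> (\<lambda>j\<in>{m..<k}. X j \<omega>)"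
    using k
  proof (induction k rule: nat_induct_at_least)
    case base
    show ?case using init w0 by (intro bexI[of _ "\<lambda>_. w0"] ballI measurable_const)
  next
    case (Suc k)
    from Suc.IH obtain \<phi> where \<phi>_meas: "\<phi> \<in> measurable (Pi\<^sub>M {m..<k} (\<lambda>_. S)) N"
      and \<phi>: "\<forall>\<omega>\<in>space M. w k \<omega> = \<phi> (\<lambda>j\<in>{m..<k}. X j \<omega>)" by (elim bexE) rule
    have res: "(\<lambda>x. restrict x {m..<k}) \<in> measurable (Pi\<^sub>M {m..<Suc k} (\<lambda>_. S)) (Pi\<^sub>M {m..<k} (\<lambda>_. S))"
      by (rule measurable_restrict_subset) auto
    have proj: "(\<lambda>x. x k) \<in> measurable (Pi\<^sub>M {m..<Suc k} (\<lambda>_. S)) S"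
      using Suc.hyps by (intro measurable_component_singleton) auto
    let ?\<phi>' = "\<lambda>x. T k (\<phi> (restrict x {m..<k}), x k)"
    have "?\<phi>' \<in> measurable (Pi\<^sub>M {m..<Suc k} (\<lambda>_. S)) N"
      by (rule measurable_compose[OF measurable_Pair[OF measurable_compose[OF res \<phi>_meas] proj] T[OF Suc.hyps]])
    moreover have "w (Suc k) \<omega> = ?\<phi>' (\<lambda>j\<in>{m..<Suc k}. X j \<omega>)" if "\<omega> \<in> space M" for \<omega>
    proof -
      have "restrict (\<lambda>j\<in>{m..<Suc k}. X j \<omega>) {m..<k} = (\<lambda>j\<in>{m..<k}. X j \<omega>)"
        by (simp add: Int_absorb1)
      moreover have "(\<lambda>j\<in>{m..<Suc k}. X j \<omega>) k = X k \<omega>" using Suc.hyps by simp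
      ultimately show ?thesis using step[OF Suc.hyps that] bspec[OF \<phi> that] by (simp only:)
    qed
    ultimately show ?case by (intro bexI[of _ ?\<phi>'] ballI)
  qed
  then obtain \<phi> where \<phi>_meas: "\<phi> \<in> measurable (Pi\<^sub>M {m..<k} (\<lambda>_. S)) N"
    and \<phi>: "\<forall>\<omega>\<in>space M. w k \<omega> = \<phi> (\<lambda>j\<in>{m..<k}. X j \<omega>)" by (elim bexE) rule
  let ?A = "Pi\<^sub>M {m..<k} (\<lambda>_. S)" and ?B = "Pi\<^sub>M {k} (\<lambda>_. S)"
  \<comment> \<open>The single sample is also written as a family, over \<open>{k}\<close>, so that
    both blocks have one type as \<open>indep_var\<close> requires. Their product law is then pushed
    forward along \<open>\<phi>\<close> and evaluation at \<open>k\<close>.\<close>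
  let ?a = "\<lambda>\<omega>. \<lambda>j\<in>{m..<k}. X j \<omega>" and ?b = "\<lambda>\<omega>. \<lambda>j\<in>{k}. X j \<omega>"
  have "indep_var ?A ?a ?B ?b"
    using k by (intro indep_var_restrict[OF indep]) auto
  then have a: "?a \<in> measurable M ?A" and b: "?b \<in> measurable M ?B"
    and ab: "distr M ?A ?a \<Otimes>\<^sub>M distr M ?B ?b = distr M (?A \<Otimes>\<^sub>M ?B) (\<lambda>\<omega>. (?a \<omega>, ?b \<omega>))"
    by (simp_all only: indep_var_distribution_eq)
  have proj: "(\<lambda>x. x k) \<in> measurable ?B S" by (intro measurable_component_singleton) simp
  have w: "w k \<in> measurable M N \<longleftrightarrow> (\<lambda>\<omega>. \<phi> (?a \<omega>)) \<in> measurable M N"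
    using \<phi> by (intro measurable_cong) auto
  have w_meas: "w k \<in> measurable M N" unfolding w by (rule measurable_compose[OF a \<phi>_meas])
  have dw: "distr M N (w k) = distr (distr M ?A ?a) N \<phi>"
    using \<phi> unfolding distr_distr[OF \<phi>_meas a] by (intro distr_cong) (simp_all add: comp_def)
  have dX: "distr M S (X k) = distr (distr M ?B ?b) S (\<lambda>x. x k)"
    unfolding distr_distr[OF proj b] by (intro distr_cong) (simp_all add: comp_def)
  have sf: "sigma_finite_measure (distr (distr M ?B ?b) S (\<lambda>x. x k))"
    unfolding dX[symmetric] using X[OF k]
    by (intro prob_space_imp_sigma_finite prob_space_distr)
  have "distr M N (w k) \<Otimes>\<^sub>M distr M S (X k)
      = distr (distr M ?A ?a \<Otimes>\<^sub>M distr M ?B ?b) (N \<Otimes>\<^sub>M S) (\<lambda>(x, y). (\<phi> x, y k))"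
    unfolding dw dX
    by (rule pair_measure_distr[OF _ _ sf]) (simp_all only: measurable_distr_eq1 \<phi>_meas proj)
  also have "\<dots> = distr M (N \<Otimes>\<^sub>M S) (\<lambda>\<omega>. (w k \<omega>, X k \<omega>))"
  proof -
    have p: "(\<lambda>(x, y). (\<phi> x, y k)) \<in> measurable (?A \<Otimes>\<^sub>M ?B) (N \<Otimes>\<^sub>M S)"
      unfolding case_prod_beta
      by (intro measurable_Pair measurable_compose[OF measurable_fst \<phi>_meas]
          measurable_compose[OF measurable_snd proj])
    show ?thesis
      unfolding ab distr_distr[OF p measurable_Pair[OF a b]] using \<phi>
      by (intro distr_cong) (simp_all add: comp_def)
  qed
  finally show ?thesis
    using w_meas X[OF k] by (simp add: indep_pair_def)
qed

text \<open>Tonelli on the product of the two laws: \<open>W\<close> may be frozen while the sample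
  is averaged, and the sample may be replaced by a copy \<open>\<xi>\<close> with the same
  law.\<close>

lemma (in prob_space) indep_pair_nn_integral_eq:
  assumes indep: "indep_pair N W S Y" and xi: "\<xi> \<in> measurable M S"
    and law: "distr M S Y = distr M S \<xi>"
    and h: "(\<lambda>(v, s). h v s) \<in> borel_measurable (N \<Otimes>\<^sub>M S)"
  shows "(\<integral>\<^sup>+\<omega>. h (W \<omega>) (Y \<omega>) \<partial>M) = (\<integral>\<^sup>+\<omega>. \<integral>\<^sup>+\<omega>'. h (W \<omega>) (\<xi> \<omega>') \<partial>M \<partial>M)"
proof -
  have W: "W \<in> measurable M N" and Y: "Y \<in> measurable M S"
    and joint: "distr M N W \<Otimes>\<^sub>M distr M S Y = distr M (N \<Otimes>\<^sub>M S) (\<lambda>x. (W x, Y x))"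
    using indep by (auto simp: indep_pair_def)
  interpret D: prob_space "distr M S \<xi>" by (rule prob_space_distr[OF xi])
  note [measurable] = W Y xi h
  have "(\<integral>\<^sup>+\<omega>. h (W \<omega>) (Y \<omega>) \<partial>M) = (\<integral>\<^sup>+x. (case x of (v, s) \<Rightarrow> h v s) \<partial>distr M (N \<Otimes>\<^sub>M S) (\<lambda>x. (W x, Y x)))"
    by (subst nn_integral_distr) auto
  also have "\<dots> = (\<integral>\<^sup>+v. \<integral>\<^sup>+s. h v s \<partial>distr M S \<xi> \<partial>distr M N W)"
    unfolding joint[symmetric] law by (subst D.nn_integral_fst[symmetric]) auto
  also have "\<dots> = (\<integral>\<^sup>+\<omega>. \<integral>\<^sup>+s. h (W \<omega>) s \<partial>distr M S \<xi> \<partial>M)"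
    by (subst nn_integral_distr) auto
  also have "\<dots> = (\<integral>\<^sup>+\<omega>. \<integral>\<^sup>+\<omega>'. h (W \<omega>) (\<xi> \<omega>') \<partial>M \<partial>M)"
  proof (rule nn_integral_cong)
    fix \<omega> assume "\<omega> \<in> space M"
    then have "W \<omega> \<in> space N" by (rule measurable_space[OF W])
    then have "h (W \<omega>) \<in> borel_measurable S"
      using measurable_Pair2[OF h] by simp
    then show "(\<integral>\<^sup>+s. h (W \<omega>) s \<partial>distr M S \<xi>) = (\<integral>\<^sup>+\<omega>'. h (W \<omega>) (\<xi> \<omega>') \<partial>M)"
      by (subst nn_integral_distr) auto
  qed
  finally show ?thesis .
qed

text \<open>The signed counterpart rests on Fubini, so integrability is assumed for the composite
  and carried over to the product law.\<close>

lemma (in prob_space) indep_pair_integral_eq: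
  fixes h :: "'b \<Rightarrow> 'c \<Rightarrow> real"
  assumes indep: "indep_pair N W S Y" and xi: "\<xi> \<in> measurable M S"
    and law: "distr M S Y = distr M S \<xi>"
    and h: "(\<lambda>(v, s). h v s) \<in> borel_measurable (N \<Otimes>\<^sub>M S)"
    and int: "integrable M (\<lambda>\<omega>. h (W \<omega>) (Y \<omega>))"
  shows "(\<integral>\<omega>. h (W \<omega>) (Y \<omega>) \<partial>M) = (\<integral>\<omega>. \<integral>\<omega>'. h (W \<omega>) (\<xi> \<omega>') \<partial>M \<partial>M)"
proof -
  have W: "W \<in> measurable M N" and Y: "Y \<in> measurable M S"
    and joint: "distr M N W \<Otimes>\<^sub>M distr M S Y = distr M (N \<Otimes>\<^sub>M S) (\<lambda>x. (W x, Y x))"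
    using indep by (auto simp: indep_pair_def)
  interpret D: prob_space "distr M S \<xi>" by (rule prob_space_distr[OF xi])
  interpret E: prob_space "distr M N W" by (rule prob_space_distr[OF W])
  interpret pair_sigma_finite "distr M N W" "distr M S \<xi>" ..
  note [measurable] = W Y xi h
  have "integrable (distr M (N \<Otimes>\<^sub>M S) (\<lambda>x. (W x, Y x))) (\<lambda>(v, s). h v s)"
    using int by (subst integrable_distr_eq) (auto simp: case_prod_beta)
  then have int': "integrable (distr M N W \<Otimes>\<^sub>M distr M S \<xi>) (\<lambda>(v, s). h v s)"
    unfolding joint[symmetric] law .
  have "(\<integral>\<omega>. h (W \<omega>) (Y \<omega>) \<partial>M) = (\<integral>x. (case x of (v, s) \<Rightarrow> h v s) \<partial>distr M (N \<Otimes>\<^sub>M S) (\<lambda>x. (W x, Y x)))"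
    by (subst integral_distr) auto
  also have "\<dots> = (\<integral>v. \<integral>s. h v s \<partial>distr M S \<xi> \<partial>distr M N W)"
    unfolding joint[symmetric] law using integral_fst'[OF int'] by simp
  also have "\<dots> = (\<integral>\<omega>. \<integral>s. h (W \<omega>) s \<partial>distr M S \<xi> \<partial>M)"
    by (subst integral_distr) auto
  also have "\<dots> = (\<integral>\<omega>. \<integral>\<omega>'. h (W \<omega>) (\<xi> \<omega>') \<partial>M \<partial>M)"
  proof (rule Bochner_Integration.integral_cong[OF refl])
    fix \<omega> assume "\<omega> \<in> space M"
    then have "W \<omega> \<in> space N" by (rule measurable_space[OF W])
    then have "h (W \<omega>) \<in> borel_measurable S"
      using measurable_Pair2[OF h] by simp
    then show "(\<integral>s. h (W \<omega>) s \<partial>distr M S \<xi>) = (\<integral>\<omega>'. h (W \<omega>) (\<xi> \<omega>') \<partial>M)"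
      by (subst integral_distr) auto
  qed
  finally show ?thesis .
qed

text \<open>Turns a bound on the sample average at each frozen point into integrability and a bound
  for the random point. Working with nonnegative integrals first delivers both at once.\<close>

lemma (in prob_space) indep_pair_integral_le:
  fixes h :: "'b \<Rightarrow> 'c \<Rightarrow> real"
  assumes indep: "indep_pair N W S Y" and xi: "\<xi> \<in> measurable M S"
    and law: "distr M S Y = distr M S \<xi>"
    and h: "(\<lambda>(v, s). h v s) \<in> borel_measurable (N \<Otimes>\<^sub>M S)"
    and nonneg: "\<And>v s. 0 \<le> h v s"
    and int: "\<And>v. integrable M (\<lambda>\<omega>. h v (\<xi> \<omega>))" and le: "\<And>v. (\<integral>\<omega>. h v (\<xi> \<omega>) \<partial>M) \<le> q v"
    and q: "integrable M (\<lambda>\<omega>. q (W \<omega>))"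
  shows "integrable M (\<lambda>\<omega>. h (W \<omega>) (Y \<omega>))"
    and "(\<integral>\<omega>. h (W \<omega>) (Y \<omega>) \<partial>M) \<le> (\<integral>\<omega>. q (W \<omega>) \<partial>M)"
proof -
  have [measurable]: "W \<in> measurable M N" "Y \<in> measurable M S"
    using indep by (auto simp: indep_pair_def)
  note [measurable] = h
  have h': "(\<lambda>\<omega>. h (W \<omega>) (Y \<omega>)) \<in> borel_measurable M" by measurable
  have "0 \<le> (\<integral>\<omega>. h v (\<xi> \<omega>) \<partial>M)" for v using nonneg by simp
  then have q0: "0 \<le> q v" for v using le order_trans by blast
  have he: "(\<lambda>(v, s). ennreal (h v s)) \<in> borel_measurable (N \<Otimes>\<^sub>M S)" by measurable
  have "(\<integral>\<^sup>+\<omega>. ennreal (h (W \<omega>) (Y \<omega>)) \<partial>M)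
      = (\<integral>\<^sup>+\<omega>. \<integral>\<^sup>+\<omega>'. ennreal (h (W \<omega>) (\<xi> \<omega>')) \<partial>M \<partial>M)"
    by (rule indep_pair_nn_integral_eq[OF indep xi law he])
  also have "\<dots> \<le> (\<integral>\<^sup>+\<omega>. ennreal (q (W \<omega>)) \<partial>M)"
    using nonneg int le by (intro nn_integral_mono) (simp add: nn_integral_eq_integral ennreal_leI)
  also have "\<dots> = ennreal (\<integral>\<omega>. q (W \<omega>) \<partial>M)"
    using q q0 by (intro nn_integral_eq_integral) auto
  finally have *: "(\<integral>\<^sup>+\<omega>. ennreal (h (W \<omega>) (Y \<omega>)) \<partial>M) \<le> ennreal (\<integral>\<omega>. q (W \<omega>) \<partial>M)" .
  show i: "integrable M (\<lambda>\<omega>. h (W \<omega>) (Y \<omega>))"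
    using h' nonneg * by (intro integrableI_nonneg) (auto simp: le_less_trans[OF _ ennreal_less_top])
  have "0 \<le> (\<integral>\<omega>. q (W \<omega>) \<partial>M)" using q0 by simp
  then show "(\<integral>\<omega>. h (W \<omega>) (Y \<omega>) \<partial>M) \<le> (\<integral>\<omega>. q (W \<omega>) \<partial>M)"
    using * nn_integral_eq_integral[OF i] nonneg by simp
qed

subsection \<open>The stochastic gradient step\<close>

text \<open>Source of the exponents 1/3 and 2/3 in the final constants: the third moment controls
  the lower ones.\<close>

lemma (in prob_space) moments_le_third_moment:
  fixes Y :: "'a \<Rightarrow> real"
  assumes Y: "Y \<in> borel_measurable M" and nonneg: "\<And>\<omega>. \<omega> \<in> space M \<Longrightarrow> 0 \<le> Y \<omega>"
    and int: "integrable M (\<lambda>\<omega>. Y \<omega> ^ 3)" and le: "(\<integral>\<omega>. Y \<omega> ^ 3 \<partial>M) \<le> m" and m: "m > 0"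
  shows "integrable M Y" and "integrable M (\<lambda>\<omega>. (Y \<omega>)\<^sup>2)"
    and "(\<integral>\<omega>. Y \<omega> \<partial>M) \<le> m powr (1/3)" and "(\<integral>\<omega>. (Y \<omega>)\<^sup>2 \<partial>M) \<le> m powr (2/3)"
proof -
  define t where "t = m powr (1/3)"
  have t: "t > 0" using m by (simp add: t_def)
  have t3: "t ^ 3 = m" using m by (simp add: t_def powr_power)
  have t2: "t\<^sup>2 = m powr (2/3)" using m by (simp add: t_def powr_power)
  txt \<open>AM-GM with equality at \<open>y = t\<close>; this replaces Hoelder's inequality.\<close>
  have b1: "y \<le> (y ^ 3 + 2 * t ^ 3) / (3 * t\<^sup>2)" if "0 \<le> y" for y
  proof -
    have "0 \<le> (y - t)\<^sup>2 * (y + 2 * t)" using t that by simp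
    also have "\<dots> = y ^ 3 + 2 * t ^ 3 - y * (3 * t\<^sup>2)"
      by (simp add: power2_eq_square power3_eq_cube algebra_simps)
    finally show ?thesis using t by (simp add: le_divide_eq)
  qed
  have b2: "y\<^sup>2 \<le> (2 * y ^ 3 + t ^ 3) / (3 * t)" if "0 \<le> y" for y
  proof -
    have "0 \<le> (y - t)\<^sup>2 * (2 * y + t)" using t that by simp
    also have "\<dots> = 2 * y ^ 3 + t ^ 3 - y\<^sup>2 * (3 * t)"
      by (simp add: power2_eq_square power3_eq_cube algebra_simps)
    finally show ?thesis using t by (simp add: le_divide_eq)
  qed
  have i1: "integrable M (\<lambda>\<omega>. (Y \<omega> ^ 3 + 2 * t ^ 3) / (3 * t\<^sup>2))"
    and i2: "integrable M (\<lambda>\<omega>. (2 * Y \<omega> ^ 3 + t ^ 3) / (3 * t))"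
    using int by auto
  show Y1: "integrable M Y"
  proof (rule Bochner_Integration.integrable_bound[OF i1 Y], rule AE_I2)
    fix \<omega> assume \<omega>: "\<omega> \<in> space M"
    show "norm (Y \<omega>) \<le> norm ((Y \<omega> ^ 3 + 2 * t ^ 3) / (3 * t\<^sup>2))"
      using b1[OF nonneg[OF \<omega>]] nonneg[OF \<omega>] unfolding real_norm_def by linarith
  qed
  show Y2: "integrable M (\<lambda>\<omega>. (Y \<omega>)\<^sup>2)"
  proof (rule Bochner_Integration.integrable_bound[OF i2 borel_measurable_power[OF Y]], rule AE_I2)
    fix \<omega> assume \<omega>: "\<omega> \<in> space M"
    show "norm ((Y \<omega>)\<^sup>2) \<le> norm ((2 * Y \<omega> ^ 3 + t ^ 3) / (3 * t))"
      using b2[OF nonneg[OF \<omega>]] zero_le_power2[of "Y \<omega>"] unfolding real_norm_def by linarith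
  qed
  have "(\<integral>\<omega>. Y \<omega> \<partial>M) \<le> (\<integral>\<omega>. (Y \<omega> ^ 3 + 2 * t ^ 3) / (3 * t\<^sup>2) \<partial>M)"
    using b1 nonneg by (intro integral_mono Y1 i1) auto
  also have "\<dots> = ((\<integral>\<omega>. Y \<omega> ^ 3 \<partial>M) + 2 * t ^ 3) / (3 * t\<^sup>2)"
    using int by (simp add: prob_space)
  also have "\<dots> \<le> (t ^ 3 + 2 * t ^ 3) / (3 * t\<^sup>2)"
    using le t t3 by (intro divide_right_mono) auto
  also have "\<dots> = t" using t by (simp add: power2_eq_square power3_eq_cube)
  finally show "(\<integral>\<omega>. Y \<omega> \<partial>M) \<le> m powr (1/3)" by (simp add: t_def)
  have "(\<integral>\<omega>. (Y \<omega>)\<^sup>2 \<partial>M) \<le> (\<integral>\<omega>. (2 * Y \<omega> ^ 3 + t ^ 3) / (3 * t) \<partial>M)"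
    using b2 nonneg by (intro integral_mono Y2 i2) auto
  also have "\<dots> = (2 * (\<integral>\<omega>. Y \<omega> ^ 3 \<partial>M) + t ^ 3) / (3 * t)"
    using int by (simp add: prob_space)
  also have "\<dots> \<le> (2 * t ^ 3 + t ^ 3) / (3 * t)"
    using le t t3 by (intro divide_right_mono) auto
  also have "\<dots> = t\<^sup>2" using t by (simp add: power2_eq_square power3_eq_cube)
  finally show "(\<integral>\<omega>. (Y \<omega>)\<^sup>2 \<partial>M) \<le> m powr (2/3)" by (simp add: t2)
qed

text \<open>The gradient vanishes at \<open>z\<close>, so it grows at most linearly in the distance
  to \<open>z\<close>, and \<open>F\<close> lies between \<open>F z\<close> and a quadratic in that
  distance. A second moment of the distance therefore suffices.\<close>

lemma (in prob_space) integrable_Lipschitz_gradient: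
  fixes F :: "'b::euclidean_space \<Rightarrow> real"
  assumes diff: "\<And>v. F differentiable (at v)"
    and lip: "\<And>u v. norm (gradient F u - gradient F v) \<le> L * norm (u - v)"
    and L: "L > 0" and min: "is_arg_min F (\<lambda>_. True) z"
    and W: "W \<in> borel_measurable M" and int: "integrable M (\<lambda>\<omega>. (norm (W \<omega> - z))\<^sup>2)"
  shows "integrable M (\<lambda>\<omega>. F (W \<omega>))" and "integrable M (\<lambda>\<omega>. (norm (gradient F (W \<omega>)))\<^sup>2)"
    and "norm (gradient F v) \<le> L * norm (v - z)"
proof -
  have g0: "gradient F z = 0" by (rule gradient_eq_0_at_arg_min[OF diff lip L min])
  then have ng: "norm (gradient F v) \<le> L * norm (v - z)" for v using lip[of v z] by simp
  then show "norm (gradient F v) \<le> L * norm (v - z)" .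
  have "continuous_on UNIV F"
    by (rule differentiable_imp_continuous_on) (simp add: differentiable_on_def diff)
  then have [measurable]: "F \<in> borel_measurable borel" by (rule borel_measurable_continuous_onI)
  have "L-lipschitz_on UNIV (gradient F)"
    using lip L by (intro lipschitz_onI) (auto simp: dist_norm)
  then have [measurable]: "gradient F \<in> borel_measurable borel"
    by (intro borel_measurable_continuous_onI lipschitz_on_continuous_on)
  note [measurable] = W
  have Fz: "F z \<le> F v" "F v \<le> F z + L / 2 * (norm (v - z))\<^sup>2" for v
    using min Lipschitz_gradient_quadratic_bound[OF diff lip, of v z] g0
    by (auto simp: is_arg_min_def not_less)
  show "integrable M (\<lambda>\<omega>. F (W \<omega>))"
  proof (rule Bochner_Integration.integrable_bound)
    show "integrable M (\<lambda>\<omega>. \<bar>F z\<bar> + L / 2 * (norm (W \<omega> - z))\<^sup>2)" using int by simp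
    have "\<bar>F v\<bar> \<le> \<bar>\<bar>F z\<bar> + L / 2 * (norm (v - z))\<^sup>2\<bar>" for v
      using Fz[of v] by linarith
    then show "AE \<omega> in M. norm (F (W \<omega>)) \<le> norm (\<bar>F z\<bar> + L / 2 * (norm (W \<omega> - z))\<^sup>2)"
      by (intro AE_I2) (simp only: real_norm_def)
  qed measurable
  show "integrable M (\<lambda>\<omega>. (norm (gradient F (W \<omega>)))\<^sup>2)"
  proof (rule Bochner_Integration.integrable_bound)
    show "integrable M (\<lambda>\<omega>. L\<^sup>2 * (norm (W \<omega> - z))\<^sup>2)" using int by simp
    have "(norm (gradient F v))\<^sup>2 \<le> L\<^sup>2 * (norm (v - z))\<^sup>2" for v
      using power_mono[OF ng[of v], of 2] by (simp add: power_mult_distrib)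
    then show "AE \<omega> in M. norm ((norm (gradient F (W \<omega>)))\<^sup>2) \<le> norm (L\<^sup>2 * (norm (W \<omega> - z))\<^sup>2)"
      by (intro AE_I2) simp
  qed measurable
qed

text \<open>Apply the quadratic bound to the displacement \<open>- a *\<^sub>R G x = - a *\<^sub>R x
  + a\<^sup>2 *\<^sub>R H x\<close>. The first part averages to the squared gradient norm;
  everything else is of order \<open>a\<^sup>2\<close>. Keeping \<open>A\<close> and
  \<open>C\<close> abstract covers both noise conditions.\<close>

lemma (in prob_space) stochastic_gradient_step:
  fixes F :: "'b::euclidean_space \<Rightarrow> real" and D :: "'b \<Rightarrow> 's \<Rightarrow> 'b" and G H :: "'b \<Rightarrow> 'b"
  assumes indep: "indep_pair borel W S Y" and xi: "\<xi> \<in> measurable M S"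
    and law: "distr M S Y = distr M S \<xi>"
    and D: "(\<lambda>(v, s). D v s) \<in> borel_measurable (borel \<Otimes>\<^sub>M S)"
    and diff: "\<And>v. F differentiable (at v)"
    and lip: "\<And>u v. norm (gradient F u - gradient F v) \<le> L * norm (u - v)"
    and L: "L > 0" and min: "is_arg_min F (\<lambda>_. True) z"
    and unbiased_int: "\<And>v. integrable M (\<lambda>\<omega>. D v (\<xi> \<omega>))"
    and unbiased: "\<And>v. (\<integral>\<omega>. D v (\<xi> \<omega>) \<partial>M) = gradient F v"
    and second_int: "\<And>v. integrable M (\<lambda>\<omega>. (norm (D v (\<xi> \<omega>)))\<^sup>2)"
    and second: "\<And>v. (\<integral>\<omega>. (norm (D v (\<xi> \<omega>)))\<^sup>2 \<partial>M) \<le> A * (norm (v - z))\<^sup>2 + C"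
    and A: "A \<ge> 0" and C: "C \<ge> 0"
    and third_int: "integrable M (\<lambda>\<omega>. norm (W \<omega> - z) ^ 3)"
    and third: "(\<integral>\<omega>. norm (W \<omega> - z) ^ 3 \<partial>M) \<le> m" and m: "m > 0"
    and G_H: "\<And>x. G x = x - a *\<^sub>R H x" and a: "a > 0"
    and G: "\<And>x. norm (G x) \<le> c_g * norm x"
    and H: "\<And>x. norm (H x) \<le> c_h * (norm x)\<^sup>2" and ch: "c_h \<ge> 0"
    and W': "\<And>\<omega>. \<omega> \<in> space M \<Longrightarrow> W' \<omega> = W \<omega> - a *\<^sub>R G (D (W \<omega>) (Y \<omega>))"
    and W'_int: "integrable M (\<lambda>\<omega>. F (W' \<omega>))"
  shows "(\<integral>\<omega>. F (W' \<omega>) \<partial>M) \<le> (\<integral>\<omega>. F (W \<omega>) \<partial>M) - a * (\<integral>\<omega>. (norm (gradient F (W \<omega>)))\<^sup>2 \<partial>M)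
    + a\<^sup>2 * (c_h * L * (A * m + C * m powr (1/3)) + L / 2 * c_g\<^sup>2 * (A * m powr (2/3) + C))"
proof -
  have [measurable]: "W \<in> borel_measurable M" "Y \<in> measurable M S"
    using indep by (auto simp: indep_pair_def)
  note [measurable] = D xi
  have W_meas: "(\<lambda>\<omega>. norm (W \<omega> - z)) \<in> borel_measurable M" by measurable
  note mom = moments_le_third_moment[OF W_meas _ third_int third m, simplified]
  note Fint = integrable_Lipschitz_gradient[OF diff lip L min \<open>W \<in> borel_measurable M\<close> mom(2)]
  have "L-lipschitz_on UNIV (gradient F)"
    using lip L by (intro lipschitz_onI) (auto simp: dist_norm)
  then have [measurable]: "gradient F \<in> borel_measurable borel"
    by (intro borel_measurable_continuous_onI lipschitz_on_continuous_on)
  let ?D = "\<lambda>\<omega>. D (W \<omega>) (Y \<omega>)"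
  have q2_int: "integrable M (\<lambda>\<omega>. A * (norm (W \<omega> - z))\<^sup>2 + C)" using mom by simp
  have q2: "(\<integral>\<omega>. A * (norm (W \<omega> - z))\<^sup>2 + C \<partial>M) \<le> A * m powr (2/3) + C"
    using mom A by (simp add: prob_space mult_left_mono)
  \<comment> \<open>The \<open>H\<close> term pairs a squared stochastic gradient with a gradient of
    size at most \<open>L * norm (v - z)\<close>. Averaging over the sample makes this cubic in the
    distance, hence the third moment.\<close>
  have q3_eq: "norm (v - z) * (A * (norm (v - z))\<^sup>2 + C) = A * norm (v - z) ^ 3 + C * norm (v - z)" for v
    by (simp add: power2_eq_square power3_eq_cube algebra_simps)
  have q3_int: "integrable M (\<lambda>\<omega>. norm (W \<omega> - z) * (A * (norm (W \<omega> - z))\<^sup>2 + C))"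
    unfolding q3_eq using mom third_int by simp
  have q3: "(\<integral>\<omega>. norm (W \<omega> - z) * (A * (norm (W \<omega> - z))\<^sup>2 + C) \<partial>M) \<le> A * m + C * m powr (1/3)"
    unfolding q3_eq using mom third_int third A C by (simp add: add_mono mult_left_mono)
  have D2_meas: "(\<lambda>(v, s). (norm (D v s))\<^sup>2) \<in> borel_measurable (borel \<Otimes>\<^sub>M S)" by measurable
  note D2 = indep_pair_integral_le[OF indep xi law D2_meas _ second_int second q2_int, simplified]
  have D3_meas: "(\<lambda>(v, s). norm (v - z) * (norm (D v s))\<^sup>2) \<in> borel_measurable (borel \<Otimes>\<^sub>M S)"
    by measurable
  have D3_nonneg: "0 \<le> norm (v - z) * (norm (D v s))\<^sup>2" for v s by simp
  have D3_int: "integrable M (\<lambda>\<omega>. norm (v - z) * (norm (D v (\<xi> \<omega>)))\<^sup>2)" for v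
    using second_int by simp
  have D3_le: "(\<integral>\<omega>. norm (v - z) * (norm (D v (\<xi> \<omega>)))\<^sup>2 \<partial>M)
      \<le> norm (v - z) * (A * (norm (v - z))\<^sup>2 + C)" for v
    using second[of v] by (simp add: mult_left_mono)
  note D3 = indep_pair_integral_le[OF indep xi law D3_meas D3_nonneg D3_int D3_le q3_int]
  have in_meas: "(\<lambda>(v, s). inner (D v s) (gradient F v)) \<in> borel_measurable (borel \<Otimes>\<^sub>M S)"
    by measurable
  have in_int: "integrable M (\<lambda>\<omega>. inner (?D \<omega>) (gradient F (W \<omega>)))"
  proof (rule Bochner_Integration.integrable_bound)
    show "integrable M (\<lambda>\<omega>. (norm (?D \<omega>))\<^sup>2 + (norm (gradient F (W \<omega>)))\<^sup>2)"
      using D2 Fint by simp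
    have "\<bar>inner x y\<bar> \<le> (norm x)\<^sup>2 + (norm y)\<^sup>2" for x y :: 'b
    proof -
      have "\<bar>inner x y\<bar> \<le> norm x * norm y" by (rule Cauchy_Schwarz_ineq2)
      also have "\<dots> \<le> (norm x)\<^sup>2 + (norm y)\<^sup>2"
        using sum_squares_bound[of "norm x" "norm y"] mult_nonneg_nonneg[OF norm_ge_zero norm_ge_zero, of x y]
        by linarith
      finally show ?thesis .
    qed
    then show "AE \<omega> in M. norm (inner (?D \<omega>) (gradient F (W \<omega>)))
        \<le> norm ((norm (?D \<omega>))\<^sup>2 + (norm (gradient F (W \<omega>)))\<^sup>2)"
      by (intro AE_I2) simp
  qed measurable
  \<comment> \<open>Unbiasedness enters here: with \<open>W\<close> frozen, the fresh sample
    averages \<open>D\<close> to the true gradient.\<close>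
  have in_eq: "(\<integral>\<omega>. inner (?D \<omega>) (gradient F (W \<omega>)) \<partial>M) = (\<integral>\<omega>. (norm (gradient F (W \<omega>)))\<^sup>2 \<partial>M)"
  proof -
    have "(\<integral>\<omega>. inner (?D \<omega>) (gradient F (W \<omega>)) \<partial>M)
        = (\<integral>\<omega>. \<integral>\<omega>'. inner (D (W \<omega>) (\<xi> \<omega>')) (gradient F (W \<omega>)) \<partial>M \<partial>M)"
      by (rule indep_pair_integral_eq[OF indep xi law in_meas in_int])
    also have "\<dots> = (\<integral>\<omega>. (norm (gradient F (W \<omega>)))\<^sup>2 \<partial>M)"
      using unbiased unbiased_int by (simp add: integral_inner_left dot_square_norm)
    finally show ?thesis .
  qed
  have pointwise: "F (W' \<omega>) \<le> F (W \<omega>) - a * inner (?D \<omega>) (gradient F (W \<omega>))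
      + a\<^sup>2 * (c_h * L * (norm (W \<omega> - z) * (norm (?D \<omega>))\<^sup>2) + L / 2 * c_g\<^sup>2 * (norm (?D \<omega>))\<^sup>2)"
    if \<omega>: "\<omega> \<in> space M" for \<omega>
  proof -
    define x g where "x = ?D \<omega>" and "g = gradient F (W \<omega>)"
    have d: "W' \<omega> - W \<omega> = - (a *\<^sub>R G x)" using W'[OF \<omega>] by (simp add: x_def)
    have "F (W' \<omega>) \<le> F (W \<omega>) + inner (- (a *\<^sub>R G x)) g + L / 2 * (norm (- (a *\<^sub>R G x)))\<^sup>2"
      using Lipschitz_gradient_quadratic_bound[OF diff lip, of "W' \<omega>" "W \<omega>"] by (simp only: d g_def)
    moreover have "inner (- (a *\<^sub>R G x)) g = - a * inner x g + a\<^sup>2 * inner (H x) g"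
      by (simp add: G_H inner_diff_left power2_eq_square algebra_simps)
    moreover have Hg: "inner (H x) g \<le> c_h * L * (norm (W \<omega> - z) * (norm x)\<^sup>2)"
    proof -
      have "inner (H x) g \<le> norm (H x) * norm g" by (rule norm_cauchy_schwarz)
      also have "\<dots> \<le> (c_h * (norm x)\<^sup>2) * (L * norm (W \<omega> - z))"
        using H Fint(3) ch by (intro mult_mono) (auto simp: g_def)
      finally show ?thesis by (simp add: mult_ac)
    qed
    moreover have GG: "(norm (- (a *\<^sub>R G x)))\<^sup>2 \<le> a\<^sup>2 * (c_g\<^sup>2 * (norm x)\<^sup>2)"
      using power_mono[OF G[of x], of 2] by (simp add: power_mult_distrib mult_left_mono)
    ultimately have "F (W' \<omega>) \<le> F (W \<omega>) + (- a * inner x g + a\<^sup>2 * (c_h * L * (norm (W \<omega> - z) * (norm x)\<^sup>2)))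
        + L / 2 * (a\<^sup>2 * (c_g\<^sup>2 * (norm x)\<^sup>2))"
      using mult_left_mono[OF Hg zero_le_power2[of a]]
        mult_left_mono[OF GG less_imp_le[OF half_gt_zero[OF L]]] by linarith
    then show ?thesis by (simp add: x_def g_def algebra_simps)
  qed
  have "(\<integral>\<omega>. F (W' \<omega>) \<partial>M) \<le> (\<integral>\<omega>. F (W \<omega>) - a * inner (?D \<omega>) (gradient F (W \<omega>))
      + a\<^sup>2 * (c_h * L * (norm (W \<omega> - z) * (norm (?D \<omega>))\<^sup>2) + L / 2 * c_g\<^sup>2 * (norm (?D \<omega>))\<^sup>2) \<partial>M)"
    using pointwise Fint(1) in_int D2(1) D3(1) W'_int by (intro integral_mono) auto
  also have "\<dots> = (\<integral>\<omega>. F (W \<omega>) \<partial>M) - a * (\<integral>\<omega>. (norm (gradient F (W \<omega>)))\<^sup>2 \<partial>M)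
      + a\<^sup>2 * (c_h * L * (\<integral>\<omega>. norm (W \<omega> - z) * (norm (?D \<omega>))\<^sup>2 \<partial>M)
        + L / 2 * c_g\<^sup>2 * (\<integral>\<omega>. (norm (?D \<omega>))\<^sup>2 \<partial>M))"
    using Fint(1) in_int D2(1) D3(1) by (simp add: in_eq)
  also have "\<dots> \<le> (\<integral>\<omega>. F (W \<omega>) \<partial>M) - a * (\<integral>\<omega>. (norm (gradient F (W \<omega>)))\<^sup>2 \<partial>M)
    + a\<^sup>2 * (c_h * L * (A * m + C * m powr (1/3)) + L / 2 * c_g\<^sup>2 * (A * m powr (2/3) + C))"
    using order_trans[OF D2(2) q2] order_trans[OF D3(2) q3] ch L
    by (intro add_left_mono mult_left_mono add_mono) auto
  finally show ?thesis .
qed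

section \<open>Expected descent along the iterates and the logarithmic rate\<close>

theorem corollary5:
  fixes P :: "'w measure" and S :: "'s measure"
    and X :: "nat \<Rightarrow> 'w \<Rightarrow> 's" and xi :: "'w \<Rightarrow> 's"
    and f :: "real ^ 'n \<Rightarrow> 's \<Rightarrow> real" and F :: "real ^ 'n \<Rightarrow> real"
    and G H :: "real ^ 'n \<Rightarrow> real \<Rightarrow> real ^ 'n"
    and \<alpha> :: "nat \<Rightarrow> real" and w :: "nat \<Rightarrow> 'w \<Rightarrow> real ^ 'n"
    and w1 wstar :: "real ^ 'n" and Lxi :: "'w \<Rightarrow> real"
    and c_g c_h L \<sigma> M \<beta> \<gamma> :: real and B :: "nat \<Rightarrow> real" and i K :: nat
  assumes prob: "prob_space P" and complete: "complete_measure P"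
    (* the data: independent random variables with the law of xi, taking values in S *)
    and indep: "prob_space.indep_vars P (\<lambda>_. S) X {1..}"
    and xi_rv: "xi \<in> measurable P S"
    and ident: "\<And>k. k \<ge> 1 \<Longrightarrow> distr P S (X k) = distr P S xi"
    (* the objective *)
    and f_measurable: "\<And>v. f v \<in> borel_measurable S"
    and f_differentiable: "\<And>v s. s \<in> space S \<Longrightarrow> (\<lambda>u. f u s) differentiable (at v)"
    and f_integrable: "\<And>v. integrable P (\<lambda>\<omega>. f v (xi \<omega>))"
    and F_eq: "\<And>v. F v = (\<integral>\<omega>. f v (xi \<omega>) \<partial>P)"
    (* the method *)
    and G_measurable: "\<And>a. a > 0 \<Longrightarrow> (\<lambda>x. G x a) \<in> borel_measurable borel"
    and G_H: "\<And>x a. a > 0 \<Longrightarrow> G x a = x - a *\<^sub>R H x a"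
    and w_1: "\<And>\<omega>. \<omega> \<in> space P \<Longrightarrow> w 1 \<omega> = w1"
    and w_Suc: "\<And>k \<omega>. k \<ge> 1 \<Longrightarrow> \<omega> \<in> space P \<Longrightarrow>
      w (Suc k) \<omega> = w k \<omega> - \<alpha> k *\<^sub>R G (gradient (\<lambda>u. f u (X k \<omega>)) (w k \<omega>)) (\<alpha> k)"
    (* growth of G and H *)
    and cg_pos: "c_g > 0" and ch_nonneg: "c_h \<ge> 0"
    and G_bound: "\<And>x a. a > 0 \<Longrightarrow> norm (G x a) \<le> c_g * norm x"
    and H_bound: "\<And>x a. a > 0 \<Longrightarrow> norm (H x a) \<le> c_h * (norm x)\<^sup>2"
    (* unbiased gradients *)
    and grad_integrable: "\<And>v. integrable P (\<lambda>\<omega>. gradient (\<lambda>u. f u (xi \<omega>)) v)"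
    and grad_unbiased: "\<And>v. (\<integral>\<omega>. gradient (\<lambda>u. f u (xi \<omega>)) v \<partial>P) = gradient F v"
    (* Lipschitz gradients *)
    and L_pos: "L > 0"
    and F_differentiable: "\<And>v. F differentiable (at v)"
    and F_C1: "continuous_on UNIV (gradient F)"
    and F_Lipschitz: "\<And>u v. norm (gradient F u - gradient F v) \<le> L * norm (u - v)"
    and Lxi_measurable: "Lxi \<in> borel_measurable (vimage_algebra (space P) xi S)"
    and Lxi_pos: "\<And>\<omega>. \<omega> \<in> space P \<Longrightarrow> Lxi \<omega> > 0"
    and Lxi_square_integrable: "integrable P (\<lambda>\<omega>. (Lxi \<omega>)\<^sup>2)"
    and f_Lipschitz: "AE \<omega> in P. \<forall>u v.
      norm (gradient (\<lambda>z. f z (xi \<omega>)) u - gradient (\<lambda>z. f z (xi \<omega>)) v) \<le> Lxi \<omega> * norm (u - v)"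
    and Lxi_bound: "(\<integral>\<omega>. (Lxi \<omega>)\<^sup>2 \<partial>P) \<le> L\<^sup>2"
    (* a minimiser of F: bounded variance (i = 1) or interpolation (i = 2), and moment bound *)
    and i_range: "i \<in> {1, 2}"
    and wstar_argmin: "is_arg_min F (\<lambda>_. True) wstar"
    and variance: "i = 1 \<Longrightarrow>
      integrable P (\<lambda>\<omega>. (norm (gradient (\<lambda>u. f u (xi \<omega>)) wstar))\<^sup>2) \<and>
      (\<integral>\<omega>. (norm (gradient (\<lambda>u. f u (xi \<omega>)) wstar))\<^sup>2 \<partial>P) \<le> \<sigma>\<^sup>2"
    and interpolation: "i = 2 \<Longrightarrow> AE \<omega> in P. is_arg_min (\<lambda>u. f u (xi \<omega>)) (\<lambda>_. True) wstar"
    and M_pos: "M > 0"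
    and moments: "\<And>k. k \<ge> 1 \<Longrightarrow>
      integrable P (\<lambda>\<omega>. norm (w k \<omega> - wstar) ^ 3) \<and>
      (\<integral>\<omega>. norm (w k \<omega> - wstar) ^ 3 \<partial>P) \<le> M"
    (* step sizes *)
    and \<beta>_pos: "\<beta> > 0" and \<gamma>_pos: "\<gamma> > 0"
    and steps: "\<And>k. k \<ge> 1 \<Longrightarrow> \<alpha> k = \<beta> / (real k + \<gamma>)"
    and B_1: "B 1 = 2 * c_h * L ^ 3 * M + 2 * c_h * L * M powr (1/3) * \<sigma>\<^sup>2
                    + c_g\<^sup>2 * L ^ 3 * M powr (2/3) + c_g\<^sup>2 * L * \<sigma>\<^sup>2"
    and B_2: "B 2 = c_h * L ^ 3 * M + c_g\<^sup>2 * L ^ 3 / 2 * M powr (2/3)"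
    and K_pos: "K \<ge> 1"
  shows "Min ((\<lambda>k. \<integral>\<omega>. (norm (gradient F (w k \<omega>)))\<^sup>2 \<partial>P) ` {1..K})
    \<le> (F w1 - F wstar) / (\<beta> * ln (real K + \<gamma> + 1))
       + B i * (\<beta> * (2 + \<gamma>) / ln (real K + \<gamma> + 1))"
proof -
  interpret prob_space P by (rule prob)
  define D where "D v s = gradient (\<lambda>u. f u s) v" for v s
  define g where "g k = (\<integral>\<omega>. (norm (gradient F (w k \<omega>)))\<^sup>2 \<partial>P)" for k
  have D_meas: "(\<lambda>(v, s). D v s) \<in> borel_measurable (borel \<Otimes>\<^sub>M S)"
    unfolding D_def by (rule borel_measurable_gradient[OF f_measurable f_differentiable])
  have \<alpha>_pos: "\<alpha> k > 0" if "k \<ge> 1" for k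
    using steps[OF that] \<beta>_pos \<gamma>_pos by simp

  \<comment> \<open>One update as a deterministic map of the current iterate and the fresh sample,
    the form needed for \<open>indep_pair_iterates\<close>.\<close>
  define T where "T k p = fst p - \<alpha> k *\<^sub>R G (D (fst p) (snd p)) (\<alpha> k)" for k p
  have T: "T k \<in> measurable (borel \<Otimes>\<^sub>M S) borel" if "k \<ge> 1" for k
  proof -
    have "(\<lambda>p. D (fst p) (snd p)) \<in> borel_measurable (borel \<Otimes>\<^sub>M S)"
      using D_meas by (simp add: case_prod_beta)
    from measurable_compose[OF this G_measurable[OF \<alpha>_pos[OF that]]]
    show ?thesis unfolding T_def
      by (intro borel_measurable_diff borel_measurable_scaleR borel_measurable_const measurable_fst)
  qed
  have indep_k: "indep_pair borel (w k) S (X k)" if "k \<ge> 1" for k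
    using indep T w_1 _ _ that
    by (rule indep_pair_iterates) (simp_all add: w_Suc T_def D_def)
  then have w_meas: "w k \<in> borel_measurable P" if "k \<ge> 1" for k
    using that by (auto simp: indep_pair_def)

  \<comment> \<open>For \<open>i = 1\<close> the factors 2 come from
    \<open>(a + b)\<^sup>2 \<le> 2 * a\<^sup>2 + 2 * b\<^sup>2\<close>, applied to the gradient at
    \<open>wstar\<close> and the Lipschitz increment. For \<open>i = 2\<close> the gradient at
    \<open>wstar\<close> vanishes almost surely, so neither the factor nor the constant
    arises.\<close>
  define A C where "A = (if i = 1 then 2 * L\<^sup>2 else L\<^sup>2)" and "C = (if i = 1 then 2 * \<sigma>\<^sup>2 else 0)"
  have AC: "A \<ge> 0" "C \<ge> 0" by (simp_all add: A_def C_def)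
  define Bi where "Bi = c_h * L * (A * M + C * M powr (1/3)) + L / 2 * c_g\<^sup>2 * (A * M powr (2/3) + C)"
  have Bi: "B i = Bi"
    using i_range B_1 B_2
    by (auto simp: Bi_def A_def C_def power2_eq_square power3_eq_cube algebra_simps)

  have D_xi_meas[measurable]: "(\<lambda>\<omega>. D v (xi \<omega>)) \<in> borel_measurable P" for v
    using grad_integrable[of v] by (simp add: D_def)
  have second: "integrable P (\<lambda>\<omega>. (norm (D v (xi \<omega>)))\<^sup>2)"
    "(\<integral>\<omega>. (norm (D v (xi \<omega>)))\<^sup>2 \<partial>P) \<le> A * (norm (v - wstar))\<^sup>2 + C" for v
  proof -
    define q where "q \<omega> = (if i = 1
      then 2 * (norm (D wstar (xi \<omega>)))\<^sup>2 + 2 * ((Lxi \<omega>)\<^sup>2 * (norm (v - wstar))\<^sup>2)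
      else (Lxi \<omega>)\<^sup>2 * (norm (v - wstar))\<^sup>2)" for \<omega>
    have q_int: "integrable P q"
      using Lxi_square_integrable variance by (cases "i = 1") (simp_all add: q_def[abs_def] D_def)
    have q_le: "(\<integral>\<omega>. q \<omega> \<partial>P) \<le> A * (norm (v - wstar))\<^sup>2 + C"
    proof -
      have "(\<integral>\<omega>. (Lxi \<omega>)\<^sup>2 \<partial>P) * (norm (v - wstar))\<^sup>2 \<le> L\<^sup>2 * (norm (v - wstar))\<^sup>2"
        using Lxi_bound by (intro mult_right_mono) auto
      then show ?thesis
        using variance Lxi_square_integrable
        by (cases "i = 1") (simp_all add: q_def[abs_def] A_def C_def D_def)
    qed
    have "AE \<omega> in P. (norm (D v (xi \<omega>)))\<^sup>2 \<le> q \<omega>"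
    proof (cases "i = 1")
      case True
      show ?thesis using f_Lipschitz
      proof eventually_elim
        case (elim \<omega>)
        define a b where "a = norm (D wstar (xi \<omega>))" and "b = Lxi \<omega> * norm (v - wstar)"
        have "norm (D v (xi \<omega>) - D wstar (xi \<omega>)) \<le> b"
          using elim by (simp add: D_def b_def)
        then have "norm (D v (xi \<omega>)) \<le> a + b"
          using norm_triangle_sub[of "D v (xi \<omega>)" "D wstar (xi \<omega>)"] by (simp add: a_def)
        then have "(norm (D v (xi \<omega>)))\<^sup>2 \<le> (a + b)\<^sup>2" by (intro power_mono) auto
        also have "\<dots> \<le> 2 * a\<^sup>2 + 2 * b\<^sup>2"
          using sum_squares_bound[of a b] by (simp add: power2_sum)
        finally show ?case using True by (simp add: q_def a_def b_def power_mult_distrib)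
      qed
    next
      case False
      then have "i = 2" using i_range by simp
      from f_Lipschitz interpolation[OF this] AE_space show ?thesis
      proof eventually_elim
        case (elim \<omega>)
        \<comment> \<open>Interpolation is used pathwise: \<open>wstar\<close> minimises the sampled
          function, whose gradient is Lipschitz with constant \<open>Lxi \<omega>\<close>.\<close>
        have "gradient (\<lambda>u. f u (xi \<omega>)) wstar = 0"
          using elim f_differentiable[OF measurable_space[OF xi_rv]] Lxi_pos
          by (intro gradient_eq_0_at_arg_min[where L = "Lxi \<omega>"]) auto
        then have "norm (D v (xi \<omega>)) \<le> Lxi \<omega> * norm (v - wstar)"
          using elim(1)[rule_format, of v wstar] by (simp add: D_def)
        from power_mono[OF this, of 2] show ?case
          using False by (simp add: q_def power_mult_distrib)
      qed
    qed
    then have AE_le: "AE \<omega> in P. norm ((norm (D v (xi \<omega>)))\<^sup>2) \<le> norm (q \<omega>)"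
      by eventually_elim simp
    show int: "integrable P (\<lambda>\<omega>. (norm (D v (xi \<omega>)))\<^sup>2)"
      by (rule Bochner_Integration.integrable_bound[OF q_int _ AE_le]) measurable
    have "(\<integral>\<omega>. (norm (D v (xi \<omega>)))\<^sup>2 \<partial>P) \<le> (\<integral>\<omega>. q \<omega> \<partial>P)"
      by (rule integral_mono_AE[OF int q_int]) fact
    with q_le show "(\<integral>\<omega>. (norm (D v (xi \<omega>)))\<^sup>2 \<partial>P) \<le> A * (norm (v - wstar))\<^sup>2 + C" by linarith
  qed

  have mom: "integrable P (\<lambda>\<omega>. (norm (w k \<omega> - wstar))\<^sup>2)"
    "(\<integral>\<omega>. (norm (w k \<omega> - wstar))\<^sup>2 \<partial>P) \<le> M powr (2/3)" if "k \<ge> 1" for k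
  proof -
    have "(\<lambda>\<omega>. norm (w k \<omega> - wstar)) \<in> borel_measurable P"
      using w_meas[OF that] by measurable
    from moments_le_third_moment(2,4)[OF this norm_ge_zero] moments[OF that] M_pos
    show "integrable P (\<lambda>\<omega>. (norm (w k \<omega> - wstar))\<^sup>2)"
      "(\<integral>\<omega>. (norm (w k \<omega> - wstar))\<^sup>2 \<partial>P) \<le> M powr (2/3)" by blast+
  qed
  note F_int = integrable_Lipschitz_gradient[OF F_differentiable F_Lipschitz L_pos wstar_argmin w_meas mom(1)]

  have step: "(\<integral>\<omega>. F (w (Suc k) \<omega>) \<partial>P) \<le> (\<integral>\<omega>. F (w k \<omega>) \<partial>P) - \<alpha> k * g k + (\<alpha> k)\<^sup>2 * Bi"
    if k: "k \<ge> 1" for k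
    unfolding g_def Bi_def
  proof (rule stochastic_gradient_step[where D = D and G = "\<lambda>x. G x (\<alpha> k)" and H = "\<lambda>x. H x (\<alpha> k)"])
    show "indep_pair borel (w k) S (X k)" by (rule indep_k[OF k])
    show "distr P S (X k) = distr P S xi" by (rule ident[OF k])
    show "integrable P (\<lambda>\<omega>. D v (xi \<omega>))" "(\<integral>\<omega>. D v (xi \<omega>) \<partial>P) = gradient F v" for v
      using grad_integrable grad_unbiased by (simp_all add: D_def)
    show "w (Suc k) \<omega> = w k \<omega> - \<alpha> k *\<^sub>R G (D (w k \<omega>) (X k \<omega>)) (\<alpha> k)" if "\<omega> \<in> space P" for \<omega>
      using w_Suc[OF k that] by (simp add: D_def)
    show "integrable P (\<lambda>\<omega>. F (w (Suc k) \<omega>))" by (rule F_int(1)) simp_all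
    show "integrable P (\<lambda>\<omega>. norm (w k \<omega> - wstar) ^ 3)" "(\<integral>\<omega>. norm (w k \<omega> - wstar) ^ 3 \<partial>P) \<le> M"
      using moments[OF k] by auto
  qed (fact xi_rv D_meas F_differentiable F_Lipschitz L_pos wstar_argmin second AC M_pos
      G_H[OF \<alpha>_pos[OF k]] \<alpha>_pos[OF k] G_bound[OF \<alpha>_pos[OF k]] H_bound[OF \<alpha>_pos[OF k]] ch_nonneg)+

  have F_le: "(\<integral>\<omega>. F (w k \<omega>) \<partial>P) \<le> F w1 - (\<Sum>j=1..<k. \<alpha> j * g j) + Bi * (\<Sum>j=1..<k. (\<alpha> j)\<^sup>2)"
    if "k \<ge> 1" for k
    using that
  proof (induction k rule: nat_induct_at_least)
    case base
    have "(\<integral>\<omega>. F (w 1 \<omega>) \<partial>P) = (\<integral>\<omega>. F w1 \<partial>P)"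
      using w_1 by (intro Bochner_Integration.integral_cong) auto
    then show ?case by (simp add: prob_space)
  next
    case (Suc k)
    then show ?case using step[OF Suc.hyps] by (simp add: algebra_simps)
  qed

  define m where "m = Min (g ` {1..K})"
  have m_le: "m \<le> g k" if "k \<in> {1..K}" for k
    using that by (simp add: m_def)
  have "m \<in> g ` {1..K}" unfolding m_def using K_pos by (intro Min_in) auto
  moreover have "0 \<le> g k" for k by (simp add: g_def)
  ultimately have m_nonneg: "0 \<le> m" by auto
  \<comment> \<open>The iterate \<open>w K\<close> counts in the minimum but not in the telescoped
    sum, so its gradient is still available to bound the remaining gap from below.\<close>
  have gap: "m / (2 * L) \<le> (\<integral>\<omega>. F (w K \<omega>) \<partial>P) - F wstar"
  proof -
    have "g K \<le> (\<integral>\<omega>. 2 * L * (F (w K \<omega>) - F wstar) \<partial>P)"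
      unfolding g_def using F_int(1,2)[OF K_pos K_pos]
      by (intro integral_mono norm_gradient_sq_le_gap[OF F_differentiable F_Lipschitz L_pos wstar_argmin]) auto
    also have "\<dots> = 2 * L * ((\<integral>\<omega>. F (w K \<omega>) \<partial>P) - F wstar)"
      using F_int(1)[OF K_pos K_pos] by (simp add: prob_space)
    finally show ?thesis using m_le[of K] K_pos L_pos by (simp add: field_simps)
  qed
  have cg: "1 \<le> c_g"
  proof -
    obtain x :: "real ^ 'n" where x: "norm x = 1" using vector_choose_size[of 1] by auto
    have "1 \<le> c_g + e" if e: "e > 0" for e
    proof -
      \<comment> \<open>Makes the contribution of \<open>H\<close> to the unit vector
        \<open>x\<close> at most \<open>e\<close>; the added 1 avoids division by 0 when
        \<open>c_h = 0\<close>.\<close>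
      define a where "a = e / (c_h + 1)"
      have a: "a > 0" using e ch_nonneg by (simp add: a_def)
      have "x = G x a + a *\<^sub>R H x a" using G_H[OF a] by simp
      then have "norm x \<le> norm (G x a) + norm (a *\<^sub>R H x a)" by (metis norm_triangle_ineq)
      also have "\<dots> \<le> c_g * norm x + a * (c_h * (norm x)\<^sup>2)"
        using G_bound[OF a] H_bound[OF a] a by (intro add_mono) (auto intro: mult_left_mono)
      also have "\<dots> \<le> c_g + e"
      proof -
        have "a * c_h \<le> a * (c_h + 1)" using a by simp
        also have "\<dots> = e" using ch_nonneg by (simp add: a_def)
        finally show ?thesis using x by simp
      qed
      finally show ?thesis using x by simp
    qed
    then show ?thesis by (rule field_le_epsilon)
  qed
  \<comment> \<open>The first gradient is bounded by the second moment of the distance. In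
    \<open>Bi\<close> only the part with \<open>c_g\<close> is kept; it suffices because
    \<open>1 \<le> c_g\<close> and \<open>L\<^sup>2 \<le> A\<close> in both cases.\<close>
  have "m * L / 2 \<le> Bi"
  proof -
    have "m \<le> g 1" using m_le K_pos by simp
    also have "g 1 \<le> (\<integral>\<omega>. L\<^sup>2 * (norm (w 1 \<omega> - wstar))\<^sup>2 \<partial>P)"
      unfolding g_def
    proof (rule integral_mono)
      show "integrable P (\<lambda>\<omega>. (norm (gradient F (w 1 \<omega>)))\<^sup>2)" by (rule F_int(2)) simp_all
      show "integrable P (\<lambda>\<omega>. L\<^sup>2 * (norm (w 1 \<omega> - wstar))\<^sup>2)" using mom(1)[of 1] by simp
      show "(norm (gradient F (w 1 \<omega>)))\<^sup>2 \<le> L\<^sup>2 * (norm (w 1 \<omega> - wstar))\<^sup>2" for \<omega>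
        using power_mono[OF F_int(3)[OF K_pos K_pos], of "w 1 \<omega>" 2] by (simp add: power_mult_distrib)
    qed
    also have "\<dots> \<le> L\<^sup>2 * M powr (2/3)" using mom[of 1] by (simp add: mult_left_mono)
    finally have "L / 2 * m \<le> L / 2 * (L\<^sup>2 * M powr (2/3))"
      using L_pos by (intro mult_left_mono) auto
    also have "\<dots> \<le> L / 2 * (c_g\<^sup>2 * (A * M powr (2/3) + C))"
    proof -
      have "L\<^sup>2 * M powr (2/3) \<le> A * M powr (2/3)"
        by (intro mult_right_mono) (auto simp: A_def)
      then have "L\<^sup>2 * M powr (2/3) \<le> A * M powr (2/3) + C" using AC by linarith
      then have "1 * (L\<^sup>2 * M powr (2/3)) \<le> c_g\<^sup>2 * (A * M powr (2/3) + C)"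
        using cg AC by (intro mult_mono) (auto simp: one_le_power)
      then show ?thesis using L_pos by (intro mult_left_mono) auto
    qed
    also have "\<dots> \<le> Bi"
      using ch_nonneg L_pos AC M_pos by (simp add: Bi_def)
    finally show ?thesis by (simp add: mult.commute)
  qed
  moreover have "m / (2 * L) \<le> (F w1 - F wstar) - (\<Sum>k=1..<K. \<beta> / (real k + \<gamma>) * g k)
      + Bi * (\<Sum>k=1..<K. (\<beta> / (real k + \<gamma>))\<^sup>2)"
    using gap F_le[OF K_pos] by (simp add: steps)
  ultimately have "m \<le> (F w1 - F wstar) / (\<beta> * ln (real K + \<gamma> + 1))
      + Bi * (\<beta> * (2 + \<gamma>) / ln (real K + \<gamma> + 1))"
    by (intro min_le_log_rate[OF \<beta>_pos \<gamma>_pos L_pos K_pos m_nonneg m_le])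
  then show ?thesis by (simp only: Bi m_def g_def[abs_def])
qed

end
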